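(* Let $C\in\mathcal C^2$, let $(U_1,V_1),(U_2,V_2),\dots$ be i.i.d. with distribution function $C$, let $E_n$ be the empirical copula of $(U_1,V_1),\dots,(U_n,V_n)$, fix $s\in(0,\tfrac12)$ and set $N(n)=\lfloor n^s\rfloor$. Then with probability one, for $\lambda$-almost every $x\in\mathbb I$, $$\lim_{n\to\infty}r_{\mathfrak{Cb}_{N(n)}(E_n)}(x)=r_C(x),$$ and in particular $\lim_{n\to\infty}\|r_{\mathfrak{Cb}_{N(n)}(E_n)}-r_C\|_p=0$ for every $p\in[1,\infty)$, where $\|f\|_p=(\int_{\mathbb I}|f|^p\,\mathrm d\lambda)^{1/p}$.
   Context: $\mathbb I=[0,1]$, $\lambda$ Lebesgue measure. A bivariate copula $C\in\mathcal C^2$ is the distribution function on $\mathbb I^2$ of a probability measure $\mu_C$ with uniform marginals. $K_C(x,\cdot)$ is the Markov kernel (conditional distribution of the second coordinate given the first), $\mu_C(B\times F)=\int_B K_C(x,F)\,\mathrm d\lambda(x)$, and $r_C(x)=\int y\,K_C(x,\mathrm dy)$. The empirical copula $E_n$ is the bilinear interpolation of the empirical subcopula induced by the (pseudo-)ranks of the sample. For $N\in\mathbb N$ and a copula $D\in\mathcal C^2$, the checkerboard approximation $\mathfrak{Cb}_N(D)$ is the copula with density $N^2\sum_{i,j=1}^N\mu_D(I_{N,i}\times I_{N,j})\mathbf 1_{I_{N,i}\times I_{N,j}}$, where $I_{N,i}=(\frac{i-1}N,\frac iN)$. *)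

theory Defs
  imports "HOL-Probability.Probability"
begin

definition copula_measure :: "(real \<times> real) measure \<Rightarrow> bool" where
  "copula_measure \<mu> \<longleftrightarrow>
     sets \<mu> = sets borel \<and> prob_space \<mu> \<and>
     emeasure \<mu> ({0..1} \<times> {0..1}) = 1 \<and>
     (\<forall>a\<in>{0..1}. measure \<mu> ({0..a} \<times> {0..1}) = a \<and> measure \<mu> ({0..1} \<times> {0..a}) = a)"

definition is_copula :: "(real \<Rightarrow> real \<Rightarrow> real) \<Rightarrow> bool" where
  "is_copula C \<longleftrightarrow> (\<exists>\<mu>. copula_measure \<mu> \<and>
     (\<forall>x\<in>{0..1}. \<forall>y\<in>{0..1}. C x y = measure \<mu> ({..x} \<times> {..y})))"

text \<open>The measure mu_C of a copula C (unique).\<close>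
definition copula_meas :: "(real \<Rightarrow> real \<Rightarrow> real) \<Rightarrow> (real \<times> real) measure" where
  "copula_meas C = (THE \<mu>. copula_measure \<mu> \<and>
     (\<forall>x\<in>{0..1}. \<forall>y\<in>{0..1}. C x y = measure \<mu> ({..x} \<times> {..y})))"

definition markov_kernel_of :: "(real \<times> real) measure \<Rightarrow> (real \<Rightarrow> real measure) \<Rightarrow> bool" where
  "markov_kernel_of \<mu> K \<longleftrightarrow>
     (\<forall>x\<in>{0..1}. sets (K x) = sets borel \<and> prob_space (K x) \<and> emeasure (K x) {0..1} = 1) \<and>
     (\<forall>F\<in>sets borel. (\<lambda>x. emeasure (K x) F) \<in> borel_measurable (restrict_space lborel {0..1})) \<and>
     (\<forall>B\<in>sets borel. \<forall>F\<in>sets borel. B \<subseteq> {0..1} \<longrightarrow> F \<subseteq> {0..1} \<longrightarrow>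
        emeasure \<mu> (B \<times> F) = (\<integral>\<^sup>+x\<in>B. emeasure (K x) F \<partial>lborel))"

definition regr :: "(real \<Rightarrow> real measure) \<Rightarrow> real \<Rightarrow> real" where
  "regr K x = integral\<^sup>L (K x) (\<lambda>y. y)"

definition grid_int :: "nat \<Rightarrow> nat \<Rightarrow> real set" where
  "grid_int N i = {(real i - 1) / real N <..< real i / real N}"

definition checkerboard :: "nat \<Rightarrow> (real \<times> real) measure \<Rightarrow> (real \<times> real) measure" where
  "checkerboard N \<mu> = density lborel (\<lambda>z. ennreal (real N ^ 2 *
     (\<Sum>i\<in>{1..N}. \<Sum>j\<in>{1..N}. measure \<mu> (grid_int N i \<times> grid_int N j) *
        indicator (grid_int N i \<times> grid_int N j) z)))"

text \<open>Bilinear interpolation on [0,1]^2 of a function given on the grid (i/n, j/n), i,j = 0..n.\<close>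
definition bilin_interp :: "nat \<Rightarrow> (nat \<Rightarrow> nat \<Rightarrow> real) \<Rightarrow> real \<Rightarrow> real \<Rightarrow> real" where
  "bilin_interp n f x y =
    (let i = min (nat \<lfloor>real n * x\<rfloor>) (n - 1); a = real n * x - real i;
         j = min (nat \<lfloor>real n * y\<rfloor>) (n - 1); b = real n * y - real j
     in (1 - a) * (1 - b) * f i j + a * (1 - b) * f (i + 1) j
        + (1 - a) * b * f i (j + 1) + a * b * f (i + 1) (j + 1))"

definition rank1 :: "(nat \<Rightarrow> 'a \<Rightarrow> real \<times> real) \<Rightarrow> nat \<Rightarrow> 'a \<Rightarrow> nat \<Rightarrow> nat" where
  "rank1 X n \<omega> k = card {l\<in>{..<n}. fst (X l \<omega>) \<le> fst (X k \<omega>)}"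

definition rank2 :: "(nat \<Rightarrow> 'a \<Rightarrow> real \<times> real) \<Rightarrow> nat \<Rightarrow> 'a \<Rightarrow> nat \<Rightarrow> nat" where
  "rank2 X n \<omega> k = card {l\<in>{..<n}. snd (X l \<omega>) \<le> snd (X k \<omega>)}"

text \<open>Empirical subcopula at grid point (i/n, j/n).\<close>
definition emp_subcopula :: "(nat \<Rightarrow> 'a \<Rightarrow> real \<times> real) \<Rightarrow> nat \<Rightarrow> 'a \<Rightarrow> nat \<Rightarrow> nat \<Rightarrow> real" where
  "emp_subcopula X n \<omega> i j =
     real (card {k\<in>{..<n}. rank1 X n \<omega> k \<le> i \<and> rank2 X n \<omega> k \<le> j}) / real n"

definition empirical_copula :: "(nat \<Rightarrow> 'a \<Rightarrow> real \<times> real) \<Rightarrow> nat \<Rightarrow> 'a \<Rightarrow> real \<Rightarrow> real \<Rightarrow> real" where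
  "empirical_copula X n \<omega> = bilin_interp n (emp_subcopula X n \<omega>)"

end

(* For x in the cell I = I_{N,i}, the regression function of the checkerboard approximation of a
   copula D is an average of cell midpoints weighted by the masses D gives to the strip over I.
   Summation by parts over the second coordinate expresses it through values of the distribution
   function on the grid, so replacing C by E_n costs O(N ||E_n - C||), which tends to 0 because
   ||E_n - C|| = O(n^(-t)) for any t < 1/2 (Hoeffding on an n-grid and Borel-Cantelli).
   For C itself the value differs from N times the integral of r_C over I by at most 1/(2N), and
   these averages converge at every Lebesgue point of r_C. *)
theory Submission
  imports Defs "HOL-Real_Asymp.Real_Asymp"
begin

section \<open>Lebesgue points\<close>

text \<open>All randomness is confined to three almost sure events: the observations lie in the unit
  square, no two of them share a coordinate, and their deviations on the grid are eventually at most
  n^(-t). None of these mentions a kernel, so once omega is fixed the claim is deterministic and can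
  be proved for every choice of kernels, each of which is determined only almost everywhere. The
  bound s < 1/2 leaves room for some t with s < t < 1/2: t < 1/2 makes the Hoeffding bounds summable
  over a grid of polynomial size, and s < t makes N(n) n^(-t) vanish. Two obstacles concern E_n. It
  is built from ranks, so its distance to C is not itself a mean of independent variables; the
  empirical distribution function of the observations serves as intermediary. And E_n has to be the
  distribution function of an actual measure before its checkerboard is meaningful: without ties the
  ranks are permutations, and mass 1/n spread uniformly over the cell addressed by each pair of
  ranks is that measure.\<close>

text \<open>The Vitali covering theorem, unlike the covering lemma, loses no constant: the set E is covered up to a null set by disjoint balls on each of which the average of |g| is at least a.\<close>

lemma maximal_weak_type:
  fixes g :: "'a::euclidean_space \<Rightarrow> real"
  assumes [measurable]: "g \<in> borel_measurable borel"
    and E: "\<And>x d. x \<in> E \<Longrightarrow> d > 0 \<Longrightarrow> \<exists>r. 0 < r \<and> r < d \<and>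
      ennreal a * emeasure lborel (ball x r) \<le> (\<integral>\<^sup>+y\<in>ball x r. ennreal \<bar>g y\<bar> \<partial>lborel)"
  obtains V where "open V" "negligible (E - V)"
    "ennreal a * emeasure lborel V \<le> (\<integral>\<^sup>+y. ennreal \<bar>g y\<bar> \<partial>lborel)"
proof -
  define \<nu> where "\<nu> = density lborel (\<lambda>y. ennreal \<bar>g y\<bar>)"
  define K where "K = {p :: 'a \<times> real. 0 < snd p \<and>
    ennreal a * emeasure lborel (ball (fst p) (snd p)) \<le> emeasure \<nu> (ball (fst p) (snd p))}"
  have \<nu>: "emeasure \<nu> (ball x r) = (\<integral>\<^sup>+y\<in>ball x r. ennreal \<bar>g y\<bar> \<partial>lborel)" for x r
    unfolding \<nu>_def by (subst emeasure_density) auto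
  \<comment> \<open>Admissible radii below every d turn the balls into a Vitali cover of E.\<close>
  have cov: "\<exists>i. i \<in> K \<and> x \<in> ball (fst i) (snd i) \<and> snd i < d" if xd: "x \<in> E" "0 < d" for x d
  proof -
    obtain r where "0 < r" "r < d" "ennreal a * emeasure lborel (ball x r) \<le> emeasure \<nu> (ball x r)"
      using E[OF xd] by (auto simp: \<nu>)
    then show ?thesis by (intro exI[of _ "(x, r)"]) (auto simp: K_def)
  qed
  obtain C where C: "countable C" "C \<subseteq> K"
     "pairwise (\<lambda>i j. disjnt (ball (fst i) (snd i)) (ball (fst j) (snd j))) C"
     "negligible (E - (\<Union>i \<in> C. ball (fst i) (snd i)))"
    using Vitali_covering_theorem_balls[of E K fst snd, OF cov] by blast
  have disj: "disjoint_family_on (\<lambda>i. ball (fst i) (snd i)) C"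
    using C(3) by (auto simp: disjoint_family_on_def pairwise_def disjnt_def)
  let ?V = "\<Union>i\<in>C. ball (fst i) (snd i)"
  show ?thesis
  proof
    show "open ?V" by auto
    show "negligible (E - ?V)" by fact
    have "ennreal a * emeasure lborel ?V =
        (\<integral>\<^sup>+i. ennreal a * emeasure lborel (ball (fst i) (snd i)) \<partial>count_space C)"
      by (subst emeasure_UN_countable) (use C disj in \<open>auto simp: nn_integral_cmult\<close>)
    also have "\<dots> \<le> (\<integral>\<^sup>+i. emeasure \<nu> (ball (fst i) (snd i)) \<partial>count_space C)"
      using C by (intro nn_integral_mono) (auto simp: K_def)
    also have "\<dots> = emeasure \<nu> ?V"
      by (subst emeasure_UN_countable) (use C disj in \<open>auto simp: \<nu>_def\<close>)
    also have "\<dots> \<le> emeasure \<nu> (space \<nu>)" by (rule emeasure_space)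
    also have "\<dots> = (\<integral>\<^sup>+y. ennreal \<bar>g y\<bar> \<partial>lborel)"
      unfolding \<nu>_def by (subst emeasure_density) auto
    finally show "ennreal a * emeasure lborel ?V \<le> (\<integral>\<^sup>+y. ennreal \<bar>g y\<bar> \<partial>lborel)" .
  qed
qed

text \<open>A measurable function is almost everywhere the pointwise limit of continuous functions;
  on a bounded set a uniform bound turns this into convergence in L1 by dominated
  convergence.\<close>

lemma bounded_approx_continuous_L1:
  fixes f :: "'a::euclidean_space \<Rightarrow> real"
  assumes f[measurable]: "f \<in> borel_measurable borel" and B: "\<And>x. \<bar>f x\<bar> \<le> B"
    and U[measurable]: "U \<in> sets borel" "bounded U" and e: "0 < e"
  obtains h where "continuous_on UNIV h" "(\<integral>\<^sup>+y\<in>U. ennreal \<bar>f y - h y\<bar> \<partial>lborel) < ennreal e"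
proof -
  have "f measurable_on UNIV"
    by (rule lebesgue_measurable_imp_measurable_on) (simp_all add: measurable_completion)
  then obtain N g where N: "negligible N" and g: "\<And>n::nat. continuous_on UNIV (g n)"
    "\<And>x. x \<notin> N \<Longrightarrow> (\<lambda>n. g n x) \<longlonglongrightarrow> f x"
    unfolding measurable_on_def by auto
  \<comment> \<open>Clipping keeps continuity, leaves the limit unchanged because |f| is at most B,
    and supplies the dominating constant 2 B.\<close>
  define h where "h n x = max (-B) (min B (g n x))" for n x
  have hc: "continuous_on UNIV (h n)" for n
    unfolding h_def by (intro continuous_intros g)
  then have [measurable]: "h n \<in> borel_measurable borel" for n
    by (rule borel_measurable_continuous_onI)
  have hB: "\<bar>h n x\<bar> \<le> B" for n x using B[of x] by (auto simp: h_def)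
  have "(\<lambda>n. \<integral>\<^sup>+y. ennreal \<bar>f y - h n y\<bar> * indicator U y \<partial>lborel) \<longlonglongrightarrow> (\<integral>\<^sup>+y. 0 \<partial>(lborel::'a measure))"
  proof (rule nn_integral_dominated_convergence)
    show "AE y in lborel. ennreal \<bar>f y - h n y\<bar> * indicator U y \<le> ennreal (2 * B) * indicator U y" for n
    proof (intro AE_I2)
      fix y show "ennreal \<bar>f y - h n y\<bar> * indicator U y \<le> ennreal (2 * B) * indicator U y"
        using hB[of n y] B[of y] by (auto simp: indicator_def intro!: ennreal_leI)
    qed
    have "(\<integral>\<^sup>+y. ennreal (2 * B) * indicator U y \<partial>lborel) = ennreal (2 * B) * emeasure lborel U"
      by (rule nn_integral_cmult_indicator) auto
    also have "\<dots> < \<infinity>"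
      using emeasure_bounded_finite[OF U(2)] by (auto simp: ennreal_mult_less_top)
    finally show "(\<integral>\<^sup>+y. ennreal (2 * B) * indicator U y \<partial>lborel) < \<infinity>" .
    have "AE y in lebesgue. y \<notin> N" using N by (auto simp: negligible_iff_null_sets intro: AE_not_in)
    then have "AE y in lborel. y \<notin> N" by (simp only: AE_completion_iff)
    then show "AE y in lborel. (\<lambda>n. ennreal \<bar>f y - h n y\<bar> * indicator U y) \<longlonglongrightarrow> 0"
    proof eventually_elim
      case (elim y)
      have "(\<lambda>n. h n y) \<longlonglongrightarrow> max (-B) (min B (f y))"
        unfolding h_def by (intro tendsto_intros g elim)
      moreover have "max (-B) (min B (f y)) = f y" using B[of y] by auto
      ultimately have "(\<lambda>n. \<bar>f y - h n y\<bar>) \<longlonglongrightarrow> \<bar>f y - f y\<bar>" by (intro tendsto_intros) simp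
      from tendsto_ennrealI[OF this]
      show ?case by (cases "y \<in> U") simp_all
    qed
  qed measurable
  then have "(\<lambda>n. \<integral>\<^sup>+y. ennreal \<bar>f y - h n y\<bar> * indicator U y \<partial>lborel) \<longlonglongrightarrow> 0" by simp
  then have "eventually (\<lambda>n. (\<integral>\<^sup>+y. ennreal \<bar>f y - h n y\<bar> * indicator U y \<partial>lborel) < ennreal e) sequentially"
    using e by (intro order_tendstoD) auto
  then obtain n where "(\<integral>\<^sup>+y. ennreal \<bar>f y - h n y\<bar> * indicator U y \<partial>lborel) < ennreal e"
    by (auto simp: eventually_sequentially)
  then show ?thesis using that hc by blast
qed

text \<open>Approximate f in L1 on U by a continuous h and put g = f - h on U. On small balls the
  oscillation of f about x is at most |g y| + |h y - h x| + |h x - f x|. The last two terms are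
  below a, by continuity and for x outside a set G of small measure, so a mean above 3 a forces the
  mean of |g| above a. The choice of e a / 2 for the L1 error gives e / 2 to G by Markov and e / 2
  to the rest by the covering argument. Outer measure is used because the bad set is not shown to be
  measurable.\<close>

lemma negligible_bad_points:
  fixes f :: "'a::euclidean_space \<Rightarrow> real"
  assumes f[measurable]: "f \<in> borel_measurable borel" and B: "\<And>x. \<bar>f x\<bar> \<le> B"
    and U: "open U" "bounded U" and a: "0 < a"
  shows "negligible {x\<in>U. \<forall>d>0. \<exists>r. 0 < r \<and> r < d \<and>
     ennreal (3 * a) * emeasure lborel (ball x r) < (\<integral>\<^sup>+y\<in>ball x r. ennreal \<bar>f y - f x\<bar> \<partial>lborel)}"
    (is "negligible ?E")
proof (subst negligible_outer_le, intro allI impI)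
  fix e :: real assume e: "0 < e"
  have [measurable]: "U \<in> sets borel" using U by auto
  obtain h where h: "continuous_on UNIV h" 
    and fh: "(\<integral>\<^sup>+y\<in>U. ennreal \<bar>f y - h y\<bar> \<partial>lborel) < ennreal (e * a / 2)"
    using bounded_approx_continuous_L1[OF f B, of U "e * a / 2"] U e a by auto
  have [measurable]: "h \<in> borel_measurable borel" using h by (rule borel_measurable_continuous_onI)
  define g where "g y = (f y - h y) * indicator U y" for y
  have [measurable]: "g \<in> borel_measurable borel" unfolding g_def by measurable
  have "(\<integral>\<^sup>+y. ennreal \<bar>g y\<bar> \<partial>lborel) = (\<integral>\<^sup>+y\<in>U. ennreal \<bar>f y - h y\<bar> \<partial>lborel)"
    by (intro nn_integral_cong) (auto simp: g_def indicator_def)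
  with fh have gint: "(\<integral>\<^sup>+y. ennreal \<bar>g y\<bar> \<partial>lborel) \<le> ennreal (e * a / 2)" by simp
  \<comment> \<open>This is the set where |g| is at least a, in the shape in which Markov's
    inequality is stated.\<close>
  define G where "G = {y\<in>space lborel. 1 \<le> ennreal (1 / a) * ennreal \<bar>g y\<bar>}"
  have Gb[measurable]: "G \<in> sets borel" unfolding G_def by measurable
  have Ga: "x \<in> G" if "a \<le> \<bar>g x\<bar>" for x
    using that a by (simp add: G_def ennreal_mult[symmetric] field_simps flip: ennreal_1)
  have "emeasure lborel G \<le> ennreal (1 / a) * (\<integral>\<^sup>+y. ennreal \<bar>g y\<bar> * indicator UNIV y \<partial>lborel)"
    unfolding G_def by (rule order_trans[OF _ nn_integral_Markov_inequality]) (auto intro!: emeasure_mono)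
  also have "\<dots> \<le> ennreal (1 / a) * ennreal (e * a / 2)" using gint by (intro mult_left_mono) auto
  also have "\<dots> = ennreal (e / 2)" using a e by (subst ennreal_mult[symmetric]) auto
  finally have Gm: "emeasure lborel G \<le> ennreal (e / 2)" .
  obtain V where V: "open V" "negligible ((?E - G) - V)"
    "ennreal a * emeasure lborel V \<le> (\<integral>\<^sup>+y. ennreal \<bar>g y\<bar> \<partial>lborel)"
  proof (rule maximal_weak_type[of g "?E - G" a])
    fix x :: 'a and d :: real assume x: "x \<in> ?E - G" and d: "d > 0"
    then have gx: "\<bar>g x\<bar> < a" using Ga[of x] by fastforce
    obtain d1 where d1: "d1 > 0" "ball x d1 \<subseteq> U" using U x open_contains_ball by blast
    have "isCont h x" using h by (simp add: continuous_on_eq_continuous_at)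
    then obtain d2 where d2: "d2 > 0" "\<And>y. dist y x < d2 \<Longrightarrow> \<bar>h y - h x\<bar> < a"
      using a unfolding continuous_at_eps_delta dist_real_def by blast
    have "0 < min d (min d1 d2)" using d d1 d2 by simp
    then obtain r where r: "0 < r" "r < min d (min d1 d2)" 
      and R: "ennreal (3 * a) * emeasure lborel (ball x r) < (\<integral>\<^sup>+y\<in>ball x r. ennreal \<bar>f y - f x\<bar> \<partial>lborel)"
      using x by blast
    let ?m = "emeasure lborel (ball x r)"
    have [measurable]: "ball x r \<in> sets borel" by simp
    have "(\<integral>\<^sup>+y\<in>ball x r. ennreal \<bar>f y - f x\<bar> \<partial>lborel) \<le>
       (\<integral>\<^sup>+y. ennreal \<bar>g y\<bar> * indicator (ball x r) y + ennreal (2 * a) * indicator (ball x r) y \<partial>lborel)"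
    proof (intro nn_integral_mono)
      fix y
      have "\<bar>f y - f x\<bar> \<le> \<bar>g y\<bar> + 2 * a" if "y \<in> ball x r"
      proof -
        have "y \<in> U" "x \<in> U" using that d1 r x by auto
        moreover have "\<bar>h y - h x\<bar> < a" using that r d2 by (auto simp: dist_commute)
        ultimately show ?thesis using gx by (auto simp: g_def)
      qed
      then show "ennreal \<bar>f y - f x\<bar> * indicator (ball x r) y
         \<le> ennreal \<bar>g y\<bar> * indicator (ball x r) y + ennreal (2 * a) * indicator (ball x r) y"
        using a by (auto simp: indicator_def ennreal_plus[symmetric] intro!: ennreal_leI simp del: ennreal_plus)
    qed
    also have "\<dots> = (\<integral>\<^sup>+y\<in>ball x r. ennreal \<bar>g y\<bar> \<partial>lborel) + ennreal (2 * a) * ?m"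
      by (subst nn_integral_add) (measurable, simp add: nn_integral_cmult_indicator)
    finally have "ennreal (3 * a) * ?m < (\<integral>\<^sup>+y\<in>ball x r. ennreal \<bar>g y\<bar> \<partial>lborel) + ennreal (2 * a) * ?m"
      using R by (rule dual_order.strict_trans1)
    moreover have "ennreal (3 * a) * ?m = ennreal a * ?m + ennreal (2 * a) * ?m"
      using a by (simp add: distrib_right[symmetric] flip: ennreal_plus)
    ultimately have "ennreal a * ?m < (\<integral>\<^sup>+y\<in>ball x r. ennreal \<bar>g y\<bar> \<partial>lborel)"
      by (intro not_le_imp_less notI) (auto dest: add_right_mono[of _ _ "ennreal (2 * a) * ?m"] simp: leD)
    then show "\<exists>r>0. r < d \<and> ennreal a * emeasure lborel (ball x r) \<le> (\<integral>\<^sup>+y\<in>ball x r. ennreal \<bar>g y\<bar> \<partial>lborel)"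
      using r by (intro exI[of _ r]) auto
  qed auto
  have "ennreal (1/a) * (ennreal a * emeasure lborel V) \<le> ennreal (1/a) * ennreal (e * a / 2)"
    using V(3) gint by (intro mult_left_mono) auto
  also have "\<dots> = ennreal (e / 2)" using a e by (subst ennreal_mult[symmetric]) auto
  also have "ennreal (1/a) * (ennreal a * emeasure lborel V) = emeasure lborel V"
    using a by (simp add: mult.assoc[symmetric] ennreal_mult[symmetric])
  finally have Vm: "emeasure lborel V \<le> ennreal (e / 2)" .
  have [measurable]: "V \<in> sets borel" using V by auto
  \<comment> \<open>The part left uncovered is only Lebesgue measurable, so the final estimate takes
    place in the completion.\<close>
  define N where "N = (?E - G) - V"
  have N: "N \<in> null_sets lebesgue" using V(2) by (simp add: negligible_iff_null_sets N_def)
  define T where "T = G \<union> V \<union> N"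
  have GVs: "G \<union> V \<in> sets lebesgue" by (auto intro!: sets_completionI_sets)
  then have Ts: "T \<in> sets lebesgue" unfolding T_def using N by auto
  have "emeasure lebesgue T = emeasure lebesgue (G \<union> V)"
    unfolding T_def using N GVs by (subst emeasure_Un_null_set) auto
  also have "\<dots> = emeasure lborel (G \<union> V)" by (subst emeasure_completion) (auto simp: main_part_sets)
  also have "\<dots> \<le> emeasure lborel G + emeasure lborel V" by (rule emeasure_subadditive) auto
  also have "\<dots> \<le> ennreal (e/2) + ennreal (e/2)" using Gm Vm by (rule add_mono)
  also have "\<dots> = ennreal e" using e by (subst ennreal_plus[symmetric]) auto
  finally have Tm: "emeasure lebesgue T \<le> ennreal e" .
  show "\<exists>T. ?E \<subseteq> T \<and> T \<in> lmeasurable \<and> measure lebesgue T \<le> e"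
  proof (intro exI conjI)
    show "?E \<subseteq> T" unfolding T_def N_def by blast
    show "T \<in> lmeasurable" using Ts Tm by (intro fmeasurableI) (auto intro: le_less_trans)
    show "measure lebesgue T \<le> e" using Tm e by (simp add: measure_def enn2real_leI)
  qed
qed

text \<open>Countably many thresholds and bounded regions suffice, so the bad points form a
  countable union of negligible sets.\<close>

lemma lebesgue_points:
  fixes f :: "'a::euclidean_space \<Rightarrow> real"
  assumes f[measurable]: "f \<in> borel_measurable borel" and B: "\<And>x. \<bar>f x\<bar> \<le> B"
  shows "AE x in lborel. \<forall>a>0. \<exists>d>0. \<forall>r. 0 < r \<and> r < d \<longrightarrow>
     (\<integral>\<^sup>+y\<in>ball x r. ennreal \<bar>f y - f x\<bar> \<partial>lborel) \<le> ennreal a * emeasure lborel (ball x r)"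
proof -
  \<comment> \<open>The 3 cancels the factor in \<open>negligible_bad_points\<close>, so the
    thresholds \<open>3 * a k\<close> are 1/(k+1).\<close>
  define a :: "nat \<Rightarrow> real" where "a k = 1 / (3 * real (Suc k))" for k
  define E where "E m k = {x\<in>ball 0 (real m). \<forall>d>0. \<exists>r. 0 < r \<and> r < d \<and>
     ennreal (3 * a k) * emeasure lborel (ball x r) < (\<integral>\<^sup>+y\<in>ball x r. ennreal \<bar>f y - f x\<bar> \<partial>lborel)}" for m k
  have "negligible (E m k)" for m k
    unfolding E_def by (rule negligible_bad_points[OF f B]) (auto simp: a_def)
  then have "AE x in lebesgue. x \<notin> E m k" for m k
    by (auto simp: negligible_iff_null_sets intro: AE_not_in)
  then have "AE x in lborel. x \<notin> E m k" for m k by (simp only: AE_completion_iff)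
  then have "AE x in lborel. \<forall>m k. x \<notin> E m k" by (simp add: AE_all_countable)
  then show ?thesis
  proof eventually_elim
    case (elim x)
    show ?case
    proof (intro allI impI)
      fix b :: real assume "0 < b"
      then obtain k where "inverse (real (Suc k)) < b" using reals_Archimedean by blast
      then have k: "3 * a k \<le> b" by (simp add: a_def field_simps)
      obtain m where "x \<in> ball 0 (real m)" using reals_Archimedean2[of "norm x"] by auto
      with elim[rule_format, of m k] obtain d where "d > 0"
        and d: "\<And>r. 0 < r \<Longrightarrow> r < d \<Longrightarrow>
           (\<integral>\<^sup>+y\<in>ball x r. ennreal \<bar>f y - f x\<bar> \<partial>lborel) \<le> ennreal (3 * a k) * emeasure lborel (ball x r)"
        unfolding E_def mem_Collect_eq not_less[symmetric] by blast
      have "ennreal (3 * a k) * emeasure lborel (ball x r) \<le> ennreal b * emeasure lborel (ball x r)" for r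
        using k by (intro mult_right_mono ennreal_leI) auto
      with d \<open>d > 0\<close> show "\<exists>d>0. \<forall>r. 0 < r \<and> r < d \<longrightarrow>
         (\<integral>\<^sup>+y\<in>ball x r. ennreal \<bar>f y - f x\<bar> \<partial>lborel) \<le> ennreal b * emeasure lborel (ball x r)"
        by (meson order_trans)
    qed
  qed
qed

section \<open>Regression functions of checkerboard approximations\<close>

text \<open>The factor N of the conditional density on a cell cancels the denominator of the cell midpoint (j - 1/2)/N.\<close>

definition cb_regr :: "nat \<Rightarrow> (real \<times> real) measure \<Rightarrow> real \<Rightarrow> real" where
  "cb_regr N \<mu> x = (\<Sum>i\<in>{1..N}. \<Sum>j\<in>{1..N}.
     measure \<mu> (grid_int N i \<times> grid_int N j) * (real j - 1 / 2) * indicator (grid_int N i) x)"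

section \<open>Integrals of the regression function of a Markov kernel\<close>

context
  fixes \<mu> :: "(real \<times> real) measure" and K :: "real \<Rightarrow> real measure"
  assumes K: "markov_kernel_of \<mu> K"
begin

lemma kernel_props:
  assumes "x \<in> {0..1}"
  shows "sets (K x) = sets borel" "prob_space (K x)" "emeasure (K x) {0..1} = 1" "AE y in K x. y \<in> {0..1}"
proof -
  show 1: "sets (K x) = sets borel" "prob_space (K x)" "emeasure (K x) {0..1} = 1"
    using K assms by (auto simp: markov_kernel_of_def)
  interpret prob_space "K x" by fact
  show "AE y in K x. y \<in> {0..1}"
    using 1 by (intro AE_prob_1) (simp add: measure_def)
qed

lemma kernel_measurable[measurable]:
  "K \<in> measurable (restrict_space lborel {0..1}) (subprob_algebra borel)"
  using K kernel_props
  by (intro measurable_subprob_algebra)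
     (auto simp: markov_kernel_of_def space_restrict_space prob_space_imp_subprob_space)

text \<open>\<open>markov_kernel_of\<close> leaves K unconstrained outside [0,1]; the indicator
  yields a function measurable on the whole line.\<close>

lemma regr_measurable[measurable]:
  "(\<lambda>x. regr K x * indicator {0..1} x) \<in> borel_measurable borel"
proof -
  have "regr K \<in> borel_measurable (restrict_space lborel {0..1})"
    unfolding regr_def by measurable
  then show ?thesis
    by (subst (asm) borel_measurable_restrict_space_iff) (auto simp: mult.commute)
qed

text \<open>The kernel identity speaks of rectangles only. Both sides are integrals of f against
  measures on the line: the second marginal of \<mu> restricted to \<open>B \<times> {0..1}\<close>,
  and the composition of Lebesgue measure on B with K. The identity says exactly that these two
  measures agree on Borel sets.\<close>

lemma kernel_nn_integral:
  fixes f :: "real \<Rightarrow> ennreal"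
  assumes \<mu>: "sets \<mu> = sets borel" and B[measurable]: "B \<in> sets borel" "B \<subseteq> {0..1}"
    and f[measurable]: "f \<in> borel_measurable borel"
  shows "(\<integral>\<^sup>+x\<in>B. (\<integral>\<^sup>+y. f y \<partial>K x) \<partial>lborel) = (\<integral>\<^sup>+z\<in>B \<times> {0..1}. f (snd z) \<partial>\<mu>)"
proof -
  have [measurable_cong]: "sets \<mu> = sets (borel \<Otimes>\<^sub>M borel)" unfolding \<mu> borel_prod ..
  let ?L = "restrict_space lborel {0..1::real}"
  have BxI[measurable]: "B \<times> {0..1::real} \<in> sets (borel \<Otimes>\<^sub>M borel)"
    by (intro pair_measureI) auto
  define \<nu>1 where "\<nu>1 = distr (density \<mu> (indicator (B \<times> {0..1}))) borel snd"
  define D where "D = density ?L (indicator B)"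
  have sD[measurable_cong]: "sets D = sets ?L" by (simp add: D_def)
  have BL[measurable]: "B \<in> sets ?L" using B by (auto simp: sets_restrict_space)
  have KD[measurable]: "K \<in> measurable D (subprob_algebra borel)" by measurable
  \<comment> \<open>On an empty space \<open>bind\<close> is a default measure unrelated to
    K.\<close>
  have ne: "space D \<noteq> {}" by (auto simp: D_def space_restrict_space)
  define \<nu>2 where "\<nu>2 = D \<bind> K"
  have [measurable]: "snd \<in> borel_measurable \<mu>" by measurable
  have "\<nu>1 = \<nu>2"
  proof (rule measure_eqI)
    show s: "sets \<nu>1 = sets \<nu>2" unfolding \<nu>1_def \<nu>2_def using ne by (subst sets_bind) (auto simp: D_def space_restrict_space kernel_props)
    fix F assume "F \<in> sets \<nu>1"
    then have F[measurable]: "F \<in> sets borel" by (simp add: \<nu>1_def)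
    have "emeasure \<nu>1 F = emeasure (density \<mu> (indicator (B \<times> {0..1}))) (snd -` F \<inter> space \<mu>)"
      unfolding \<nu>1_def by (subst emeasure_distr) auto
    also have "\<dots> = (\<integral>\<^sup>+z. indicator (B \<times> {0..1}) z * indicator (snd -` F \<inter> space \<mu>) z \<partial>\<mu>)"
      by (subst emeasure_density) auto
    also have "\<dots> = (\<integral>\<^sup>+z. indicator (B \<times> (F \<inter> {0..1})) z \<partial>\<mu>)"
      using sets_eq_imp_space_eq[OF \<mu>] by (intro nn_integral_cong) (auto simp: indicator_def)
    also have "\<dots> = emeasure \<mu> (B \<times> (F \<inter> {0..1}))"
      by (intro nn_integral_indicator) (auto simp: \<mu> intro!: borel_Times)
    \<comment> \<open>The kernel identity covers only subsets of [0,1]; F was cut down for this step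
      and is restored next, as K x is concentrated on [0,1].\<close>
    also have "\<dots> = (\<integral>\<^sup>+x\<in>B. emeasure (K x) (F \<inter> {0..1}) \<partial>lborel)"
      using K B F unfolding markov_kernel_of_def by auto
    also have "\<dots> = (\<integral>\<^sup>+x. indicator B x * emeasure (K x) F * indicator {0..1} x \<partial>lborel)"
    proof (intro nn_integral_cong)
      fix x
      have "emeasure (K x) (F \<inter> {0..1}) = emeasure (K x) F" if "x \<in> B"
      proof -
        have x: "x \<in> {0..1}" using that B by auto
        note Kp = kernel_props[OF x]
        show ?thesis using Kp(4) F by (intro emeasure_eq_AE) (auto simp: Kp(1))
      qed
      then show "emeasure (K x) (F \<inter> {0..1}) * indicator B x = indicator B x * emeasure (K x) F * indicator {0..1} x"
        using B by (auto simp: indicator_def)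
    qed
    also have "\<dots> = (\<integral>\<^sup>+x. indicator B x * emeasure (K x) F \<partial>?L)"
      by (subst nn_integral_restrict_space) (auto simp: mult_ac)
    also have "\<dots> = (\<integral>\<^sup>+x. emeasure (K x) F \<partial>D)"
      unfolding D_def by (subst nn_integral_density) auto
    also have "\<dots> = emeasure \<nu>2 F"
      unfolding \<nu>2_def by (rule emeasure_bind[OF ne KD F, symmetric])
    finally show "emeasure \<nu>1 F = emeasure \<nu>2 F" .
  qed
  have "(\<integral>\<^sup>+x\<in>B. (\<integral>\<^sup>+y. f y \<partial>K x) \<partial>lborel) = (\<integral>\<^sup>+x. indicator B x * (\<integral>\<^sup>+y. f y \<partial>K x) \<partial>?L)"
    using B by (subst nn_integral_restrict_space) (auto simp: indicator_def intro!: nn_integral_cong)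
  also have "\<dots> = (\<integral>\<^sup>+x. (\<integral>\<^sup>+y. f y \<partial>K x) \<partial>D)"
    unfolding D_def by (subst nn_integral_density) auto
  also have "\<dots> = (\<integral>\<^sup>+y. f y \<partial>\<nu>2)"
    unfolding \<nu>2_def by (subst nn_integral_bind[OF f KD]) auto
  also have "\<dots> = (\<integral>\<^sup>+z. f (snd z) \<partial>density \<mu> (indicator (B \<times> {0..1})))"
    unfolding \<open>\<nu>1 = \<nu>2\<close>[symmetric] \<nu>1_def by (subst nn_integral_distr) auto
  also have "\<dots> = (\<integral>\<^sup>+z\<in>B \<times> {0..1}. f (snd z) \<partial>\<mu>)"
    by (subst nn_integral_density) (auto simp: mult.commute)
  finally show ?thesis .
qed

lemma regr_nn_integral:
  assumes "x \<in> {0..1}"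
  shows "ennreal (regr K x) = (\<integral>\<^sup>+y. ennreal y \<partial>K x)" "0 \<le> regr K x" "regr K x \<le> 1"
proof -
  note Kp = kernel_props[OF assms]
  interpret prob_space "K x" by fact
  have m: "(\<lambda>y. y) \<in> borel_measurable (K x)" using Kp(1) by (simp cong: measurable_cong_sets)
  have i: "integrable (K x) (\<lambda>y. y)"
    using Kp(4) m by (intro integrable_const_bound[of _ 1]) auto
  show "ennreal (regr K x) = (\<integral>\<^sup>+y. ennreal y \<partial>K x)"
    unfolding regr_def using Kp(4) i by (subst nn_integral_eq_integral) auto
  show "0 \<le> regr K x" unfolding regr_def using Kp(4) by (intro integral_nonneg_AE) auto
  have "regr K x \<le> (\<integral>y. 1 \<partial>K x)" unfolding regr_def using Kp(4) i by (intro integral_mono_AE) auto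
  then show "regr K x \<le> 1" by (simp add: prob_space)
qed

lemma regr_set_nn_integral:
  assumes \<mu>: "sets \<mu> = sets borel" and B: "B \<in> sets borel" "B \<subseteq> {0..1}"
  shows "(\<integral>\<^sup>+x\<in>B. ennreal (regr K x) \<partial>lborel) = (\<integral>\<^sup>+z\<in>B \<times> {0..1}. ennreal (snd z) \<partial>\<mu>)"
proof -
  have "(\<integral>\<^sup>+x\<in>B. ennreal (regr K x) \<partial>lborel) = (\<integral>\<^sup>+x\<in>B. (\<integral>\<^sup>+y. ennreal y \<partial>K x) \<partial>lborel)"
    using B by (intro nn_integral_cong) (auto simp: indicator_def regr_nn_integral(1))
  also have "\<dots> = (\<integral>\<^sup>+z\<in>B \<times> {0..1}. ennreal (snd z) \<partial>\<mu>)"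
    by (rule kernel_nn_integral[OF \<mu> B]) measurable
  finally show ?thesis .
qed

end

section \<open>The regression function of a checkerboard measure\<close>

lemma nn_integral_id_grid_int:
  assumes "0 < N" "1 \<le> j"
  shows "(\<integral>\<^sup>+y\<in>grid_int N j. ennreal y \<partial>lborel) = ennreal ((real j - 1 / 2) / real N ^ 2)"
proof -
  let ?a = "(real j - 1) / real N" and ?b = "real j / real N"
  have ab: "?a \<le> ?b" "0 \<le> ?a" using assms by (auto simp: divide_right_mono)
  have ae: "AE y in lborel. y \<noteq> ?a" "AE y in lborel. y \<noteq> ?b" by (rule AE_lborel_singleton)+
  have "(\<integral>\<^sup>+y\<in>grid_int N j. ennreal y \<partial>lborel) = (\<integral>\<^sup>+y\<in>{?a..?b}. ennreal y \<partial>lborel)"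
    by (intro nn_integral_cong_AE, use ae in eventually_elim) (auto simp: grid_int_def indicator_def)
  also have "\<dots> = ennreal (?b ^ 2 / 2 - ?a ^ 2 / 2)"
    using ab by (intro nn_integral_FTC_Icc) (auto intro!: derivative_eq_intros)
  also have "?b ^ 2 / 2 - ?a ^ 2 / 2 = (real j - 1 / 2) / real N ^ 2"
    using assms by (simp add: field_simps power2_eq_square)
  finally show ?thesis .
qed

lemma grid_int_borel[measurable]: "grid_int N i \<in> sets borel"
  by (simp add: grid_int_def)

lemma grid_int_subset:
  assumes i: "1 \<le> i" "i \<le> N"
  shows "grid_int N i \<subseteq> {0..1}"
proof
  fix x assume "x \<in> grid_int N i"
  then have "(real i - 1) / real N < x" "x < real i / real N" by (auto simp: grid_int_def)
  moreover have "0 \<le> (real i - 1) / real N" "real i / real N \<le> 1" using i by auto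
  ultimately show "x \<in> {0..1}" by auto
qed

lemma cb_regr_nonneg: "0 \<le> cb_regr N \<mu> x"
  unfolding cb_regr_def by (intro sum_nonneg mult_nonneg_nonneg) auto

lemma cb_regr_measurable[measurable]: "cb_regr N \<mu> \<in> borel_measurable borel"
  unfolding cb_regr_def by measurable

text \<open>By Fubini both functions have the same integral over every Borel subset of [0,1], and
  densities are unique up to null sets. Equality can only be almost everywhere, since K is an
  arbitrary version of the kernel.\<close>

lemma checkerboard_regr:
  assumes K: "markov_kernel_of (checkerboard N \<mu>) K" and N: "0 < N"
  shows "AE x in lborel. x \<in> {0..1} \<longrightarrow> regr K x = cb_regr N \<mu> x"
proof -
  have [measurable]: "grid_int N i \<times> grid_int N j \<in> sets (borel \<Otimes>\<^sub>M borel)" for i j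
    by (intro pair_measureI) auto
  have [measurable]: "(\<lambda>x. regr K x * indicator {0..1} x) \<in> borel_measurable borel"
    using regr_measurable[OF K] .
  let ?m = "\<lambda>i j. measure \<mu> (grid_int N i \<times> grid_int N j)"
  define d where "d z = real N ^ 2 *
     (\<Sum>i\<in>{1..N}. \<Sum>j\<in>{1..N}. ?m i j * indicator (grid_int N i \<times> grid_int N j) z)" for z :: "real \<times> real"
  have dm[measurable]: "d \<in> borel_measurable (borel \<Otimes>\<^sub>M borel)" unfolding d_def by measurable
  have cb: "checkerboard N \<mu> = density lborel (\<lambda>z. ennreal (d z))"
    by (simp add: checkerboard_def d_def)
  \<comment> \<open>All cells lie in [0,1], which absorbs the second indicator; the factor N^2 of
    the density cancels the denominator of the integral of y over a cell.\<close>
  have inner: "(\<integral>\<^sup>+y. ennreal (d (x, y)) * (ennreal y * indicator {0..1} y) \<partial>lborel) = ennreal (cb_regr N \<mu> x)" for x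
  proof -
    have "ennreal (d (x, y)) * (ennreal y * indicator {0..1} y) =
       (\<Sum>i\<in>{1..N}. \<Sum>j\<in>{1..N}. ennreal (real N ^ 2 * ?m i j * indicator (grid_int N i) x) *
          (ennreal y * indicator (grid_int N j) y))" for y
    proof -
      have "ennreal (d (x, y)) = (\<Sum>i\<in>{1..N}. \<Sum>j\<in>{1..N}. 
        ennreal (real N ^ 2 * ?m i j * indicator (grid_int N i) x * indicator (grid_int N j) y))"
        unfolding d_def sum_distrib_left
        by (simp add: sum_ennreal sum_nonneg indicator_times mult.assoc)
      then have "ennreal (d (x, y)) * (ennreal y * indicator {0..1} y) =
         (\<Sum>i\<in>{1..N}. \<Sum>j\<in>{1..N}. ennreal (real N ^ 2 * ?m i j * indicator (grid_int N i) x * indicator (grid_int N j) y)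
            * (ennreal y * indicator {0..1} y))"
        by (simp only: sum_distrib_right)
      also have "\<dots> = (\<Sum>i\<in>{1..N}. \<Sum>j\<in>{1..N}. ennreal (real N ^ 2 * ?m i j * indicator (grid_int N i) x) *
          (ennreal y * indicator (grid_int N j) y))"
      proof (intro sum.cong refl)
        fix i j assume "j \<in> {1..N}"
        then have "y \<in> grid_int N j \<Longrightarrow> y \<in> {0..1}" using grid_int_subset[of j N] by auto
        then show "ennreal (real N ^ 2 * ?m i j * indicator (grid_int N i) x * indicator (grid_int N j) y)
            * (ennreal y * indicator {0..1} y) = ennreal (real N ^ 2 * ?m i j * indicator (grid_int N i) x) *
          (ennreal y * indicator (grid_int N j) y)"
          by (cases "y \<in> grid_int N j") auto
      qed
      finally show ?thesis .
    qed
    then have "(\<integral>\<^sup>+y. ennreal (d (x, y)) * (ennreal y * indicator {0..1} y) \<partial>lborel) =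
       (\<Sum>i\<in>{1..N}. \<Sum>j\<in>{1..N}. ennreal (real N ^ 2 * ?m i j * indicator (grid_int N i) x) *
          (\<integral>\<^sup>+y. ennreal y * indicator (grid_int N j) y \<partial>lborel))"
      by (simp add: nn_integral_sum nn_integral_cmult)
    also have "\<dots> = (\<Sum>i\<in>{1..N}. \<Sum>j\<in>{1..N}. ennreal (?m i j * (real j - 1/2) * indicator (grid_int N i) x))"
      using N by (intro sum.cong refl)
        (simp add: nn_integral_id_grid_int ennreal_mult[symmetric] mult_ac)
    also have "\<dots> = ennreal (cb_regr N \<mu> x)"
      unfolding cb_regr_def by (subst sum_ennreal; (subst sum_ennreal)?) (auto intro!: sum_nonneg mult_nonneg_nonneg)
    finally show ?thesis .
  qed
  have "AE x in lborel. ennreal (regr K x * indicator {0..1} x) = ennreal (cb_regr N \<mu> x * indicator {0..1} x)"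
  proof (rule sigma_finite_measure.density_unique2)
    fix A :: "real set" assume "A \<in> sets lborel"
    then have A[measurable]: "A \<in> sets borel" by simp
    define B where "B = A \<inter> {0..1}"
    have B[measurable]: "B \<in> sets borel" "B \<subseteq> {0..1}" by (auto simp: B_def)
    have BI[measurable]: "B \<times> {0..1::real} \<in> sets (borel \<Otimes>\<^sub>M borel)" by (intro pair_measureI) auto
    have "(\<integral>\<^sup>+x\<in>A. ennreal (regr K x * indicator {0..1} x) \<partial>lborel) = (\<integral>\<^sup>+x\<in>B. ennreal (regr K x) \<partial>lborel)"
      by (intro nn_integral_cong) (auto simp: B_def indicator_def)
    also have "\<dots> = (\<integral>\<^sup>+z\<in>B \<times> {0..1}. ennreal (snd z) \<partial>checkerboard N \<mu>)"
      by (rule regr_set_nn_integral[OF K _ B]) (simp add: checkerboard_def)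
    also have "\<dots> = (\<integral>\<^sup>+z. ennreal (d z) * (ennreal (snd z) * indicator (B \<times> {0..1}) z) \<partial>(lborel \<Otimes>\<^sub>M lborel))"
      unfolding cb lborel_prod[symmetric] by (subst nn_integral_density) auto
    also have "\<dots> = (\<integral>\<^sup>+x. \<integral>\<^sup>+y. ennreal (d (x, y)) * (ennreal y * indicator (B \<times> {0..1}) (x, y)) \<partial>lborel \<partial>lborel)"
      by (subst lborel.nn_integral_fst[symmetric]) auto
    also have "\<dots> = (\<integral>\<^sup>+x. indicator B x * (\<integral>\<^sup>+y. ennreal (d (x, y)) * (ennreal y * indicator {0..1} y) \<partial>lborel) \<partial>lborel)"
      by (intro nn_integral_cong) (auto simp: indicator_def)
    also have "\<dots> = (\<integral>\<^sup>+x\<in>A. ennreal (cb_regr N \<mu> x * indicator {0..1} x) \<partial>lborel)"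
      unfolding inner by (intro nn_integral_cong) (auto simp: B_def indicator_def)
    finally show "(\<integral>\<^sup>+x\<in>A. ennreal (regr K x * indicator {0..1} x) \<partial>lborel) =
       (\<integral>\<^sup>+x\<in>A. ennreal (cb_regr N \<mu> x * indicator {0..1} x) \<partial>lborel)" .
  qed (auto intro: lborel.sigma_finite_measure_axioms)
  then show ?thesis
    by eventually_elim (auto simp: cb_regr_nonneg regr_nn_integral(2)[OF K])
qed

section \<open>Copula measures and their distribution functions\<close>

definition cdf2 :: "(real \<times> real) measure \<Rightarrow> real \<Rightarrow> real \<Rightarrow> real" where
  "cdf2 \<mu> u v = measure \<mu> ({..u} \<times> {..v})"

context
  fixes \<mu> :: "(real \<times> real) measure"
  assumes cm: "copula_measure \<mu>"
begin

lemma copula_prob_space: "prob_space \<mu>"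
  using cm by (simp add: copula_measure_def)

interpretation prob_space \<mu> by (rule copula_prob_space)

lemma copula_sets: "sets \<mu> = sets borel"
  using cm by (simp add: copula_measure_def)

lemma copula_space: "space \<mu> = UNIV"
  using sets_eq_imp_space_eq[OF copula_sets] by simp

lemma copula_Times: "A \<in> sets borel \<Longrightarrow> B \<in> sets borel \<Longrightarrow> A \<times> B \<in> sets \<mu>"
  by (simp add: copula_sets borel_Times)

lemma copula_AE_square: "AE z in \<mu>. z \<in> {0..1} \<times> {0..1}"
proof (rule AE_prob_1)
  show "prob ({0..1} \<times> {0..1}) = 1" using cm by (simp add: copula_measure_def measure_def)
qed

lemma copula_margin1: "measure \<mu> ({..a} \<times> UNIV) = max 0 (min 1 a)"
proof -
  let ?a = "max 0 (min 1 a)"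
  have "measure \<mu> ({..a} \<times> UNIV) = (if a < 0 then 0 else measure \<mu> ({0..?a} \<times> {0..1}))"
  proof (cases "a < 0")
    case True
    have "AE z in \<mu>. z \<notin> {..a} \<times> UNIV"
      using copula_AE_square by eventually_elim (use True in auto)
    then show ?thesis using True by (simp add: prob_eq_0 copula_Times)
  next
    case False
    have "measure \<mu> ({..a} \<times> UNIV) = measure \<mu> ({0..?a} \<times> {0..1})"
      by (intro finite_measure_eq_AE copula_Times, use copula_AE_square in eventually_elim) (use False in auto)
    then show ?thesis using False by simp
  qed
  then show ?thesis using cm by (auto simp: copula_measure_def max_def min_def)
qed

lemma copula_margin2: "measure \<mu> (UNIV \<times> {..a}) = max 0 (min 1 a)"
proof -
  let ?a = "max 0 (min 1 a)"
  have "measure \<mu> (UNIV \<times> {..a}) = (if a < 0 then 0 else measure \<mu> ({0..1} \<times> {0..?a}))"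
  proof (cases "a < 0")
    case True
    have "AE z in \<mu>. z \<notin> UNIV \<times> {..a}"
      using copula_AE_square by eventually_elim (use True in auto)
    then show ?thesis using True by (simp add: prob_eq_0 copula_Times)
  next
    case False
    have "measure \<mu> (UNIV \<times> {..a}) = measure \<mu> ({0..1} \<times> {0..?a})"
      by (intro finite_measure_eq_AE copula_Times, use copula_AE_square in eventually_elim) (use False in auto)
    then show ?thesis using False by simp
  qed
  then show ?thesis using cm by (auto simp: copula_measure_def max_def min_def)
qed

lemma copula_strip1: "a \<le> b \<Longrightarrow> measure \<mu> ({a<..b} \<times> UNIV) \<le> b - a"
proof -
  assume ab: "a \<le> b"
  have "{a<..b} \<times> UNIV = {..b} \<times> UNIV - {..a} \<times> (UNIV :: real set)" by auto
  also have "measure \<mu> \<dots> = measure \<mu> ({..b} \<times> UNIV) - measure \<mu> ({..a} \<times> UNIV)"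
    using ab by (intro finite_measure_Diff copula_Times) auto
  finally show ?thesis using ab by (simp add: copula_margin1)
qed

lemma copula_strip2: "a \<le> b \<Longrightarrow> measure \<mu> (UNIV \<times> {a<..b}) \<le> b - a"
proof -
  assume ab: "a \<le> b"
  have "UNIV \<times> {a<..b} = UNIV \<times> {..b} - (UNIV :: real set) \<times> {..a}" by auto
  also have "measure \<mu> \<dots> = measure \<mu> (UNIV \<times> {..b}) - measure \<mu> (UNIV \<times> {..a})"
    using ab by (intro finite_measure_Diff copula_Times) auto
  finally show ?thesis using ab by (simp add: copula_margin2)
qed

text \<open>A strip of width e around the line has mass at most e. Null lines let open and half-open
  rectangles be exchanged and later exclude ties among the observations.\<close>

lemma copula_line1: "AE z in \<mu>. fst z \<noteq> a"
proof -
  have "measure \<mu> ({a} \<times> UNIV) \<le> 0"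
  proof (rule field_le_epsilon)
    fix e :: real assume "0 < e"
    then have "measure \<mu> ({a} \<times> UNIV) \<le> measure \<mu> ({a - e<..a} \<times> UNIV)"
      by (intro finite_measure_mono copula_Times) auto
    also have "\<dots> \<le> e" using copula_strip1[of "a - e" a] \<open>0 < e\<close> by simp
    finally show "measure \<mu> ({a} \<times> UNIV) \<le> 0 + e" by simp
  qed
  then have "measure \<mu> ({a} \<times> UNIV) = 0" by (simp add: measure_le_0_iff)
  then have "AE z in \<mu>. z \<notin> {a} \<times> UNIV" by (subst (asm) prob_eq_0) (auto intro: copula_Times)
  then show ?thesis by eventually_elim auto
qed

lemma copula_line2: "AE z in \<mu>. snd z \<noteq> a"
proof -
  have "measure \<mu> (UNIV \<times> {a}) \<le> 0"
  proof (rule field_le_epsilon)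
    fix e :: real assume "0 < e"
    then have "measure \<mu> (UNIV \<times> {a}) \<le> measure \<mu> (UNIV \<times> {a - e<..a})"
      by (intro finite_measure_mono copula_Times) auto
    also have "\<dots> \<le> e" using copula_strip2[of "a - e" a] \<open>0 < e\<close> by simp
    finally show "measure \<mu> (UNIV \<times> {a}) \<le> 0 + e" by simp
  qed
  then have "measure \<mu> (UNIV \<times> {a}) = 0" by (simp add: measure_le_0_iff)
  then have "AE z in \<mu>. z \<notin> UNIV \<times> {a}" by (subst (asm) prob_eq_0) (auto intro: copula_Times)
  then show ?thesis by eventually_elim auto
qed

lemma cdf2_mono: "u \<le> u' \<Longrightarrow> v \<le> v' \<Longrightarrow> cdf2 \<mu> u v \<le> cdf2 \<mu> u' v'"
  unfolding cdf2_def by (intro finite_measure_mono copula_Times) auto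

lemma cdf2_increment_le:
  assumes "u \<le> u'" "v \<le> v'"
  shows "cdf2 \<mu> u' v' - cdf2 \<mu> u v \<le> (u' - u) + (v' - v)"
proof -
  have "cdf2 \<mu> u' v' \<le> measure \<mu> ({..u} \<times> {..v} \<union> ({u<..u'} \<times> UNIV \<union> UNIV \<times> {v<..v'}))"
    unfolding cdf2_def by (intro finite_measure_mono sets.Un copula_Times) auto
  also have "\<dots> \<le> cdf2 \<mu> u v + (measure \<mu> ({u<..u'} \<times> UNIV) + measure \<mu> (UNIV \<times> {v<..v'}))"
    unfolding cdf2_def
    by (intro order_trans[OF measure_Un_le] add_mono order_refl sets.Un copula_Times) auto
  finally show ?thesis using copula_strip1[OF assms(1)] copula_strip2[OF assms(2)] by simp
qed

text \<open>The two points need not be comparable, so both are compared with their coordinatewise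
  minimum.\<close>

lemma cdf2_lipschitz: "\<bar>cdf2 \<mu> u v - cdf2 \<mu> u' v'\<bar> \<le> \<bar>u - u'\<bar> + \<bar>v - v'\<bar>"
proof -
  let ?a = "min u u'" and ?b = "min v v'"
  have "cdf2 \<mu> u v - cdf2 \<mu> ?a ?b \<le> (u - ?a) + (v - ?b)" "cdf2 \<mu> ?a ?b \<le> cdf2 \<mu> u v"
       "cdf2 \<mu> u' v' - cdf2 \<mu> ?a ?b \<le> (u' - ?a) + (v' - ?b)" "cdf2 \<mu> ?a ?b \<le> cdf2 \<mu> u' v'"
    by (intro cdf2_increment_le cdf2_mono; simp)+
  then show ?thesis by (auto simp: min_def abs_if split: if_splits)
qed

lemma cdf2_clamp: "cdf2 \<mu> u v = (if u < 0 \<or> v < 0 then 0 else cdf2 \<mu> (min 1 u) (min 1 v))"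
proof (cases "u < 0 \<or> v < 0")
  case True
  have "AE z in \<mu>. z \<notin> {..u} \<times> {..v}"
      using copula_AE_square by eventually_elim (use True in auto)
  then show ?thesis using True by (simp add: prob_eq_0 copula_Times cdf2_def)
next
  case False
  have "cdf2 \<mu> u v = cdf2 \<mu> (min 1 u) (min 1 v)"
    unfolding cdf2_def
    by (intro finite_measure_eq_AE copula_Times, use copula_AE_square in eventually_elim) auto
  then show ?thesis using False by simp
qed

lemma cdf2_margin1: "1 \<le> v \<Longrightarrow> cdf2 \<mu> u v = max 0 (min 1 u)"
proof -
  assume "1 \<le> v"
  have "cdf2 \<mu> u v = measure \<mu> ({..u} \<times> UNIV)"
    unfolding cdf2_def
    by (intro finite_measure_eq_AE copula_Times, use copula_AE_square in eventually_elim)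
       (use \<open>1 \<le> v\<close> in auto)
  then show ?thesis by (simp add: copula_margin1)
qed

lemma cdf2_margin2: "1 \<le> u \<Longrightarrow> cdf2 \<mu> u v = max 0 (min 1 v)"
proof -
  assume "1 \<le> u"
  have "cdf2 \<mu> u v = measure \<mu> (UNIV \<times> {..v})"
    unfolding cdf2_def
    by (intro finite_measure_eq_AE copula_Times, use copula_AE_square in eventually_elim)
       (use \<open>1 \<le> u\<close> in auto)
  then show ?thesis by (simp add: copula_margin2)
qed

lemma copula_rectangle:
  assumes ab: "a \<le> b" and cd: "c \<le> d"
  shows "measure \<mu> ({a<..<b} \<times> {c<..<d}) = cdf2 \<mu> b d - cdf2 \<mu> a d - cdf2 \<mu> b c + cdf2 \<mu> a c"
proof -
  have strip: "measure \<mu> ({a<..b} \<times> {..v}) = cdf2 \<mu> b v - cdf2 \<mu> a v" for v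
  proof -
    have "{a<..b} \<times> {..v} = {..b} \<times> {..v} - {..a} \<times> {..v}" by auto
    also have "measure \<mu> \<dots> = cdf2 \<mu> b v - cdf2 \<mu> a v"
      unfolding cdf2_def using ab by (intro finite_measure_Diff copula_Times) auto
    finally show ?thesis .
  qed
  have "measure \<mu> ({a<..<b} \<times> {c<..<d}) = measure \<mu> ({a<..b} \<times> {c<..d})"
    by (intro finite_measure_eq_AE copula_Times, use copula_line1[of b] copula_line2[of d] in eventually_elim) auto
  also have "{a<..b} \<times> {c<..d} = {a<..b} \<times> {..d} - {a<..b} \<times> {..c}" by auto
  also have "measure \<mu> \<dots> = measure \<mu> ({a<..b} \<times> {..d}) - measure \<mu> ({a<..b} \<times> {..c})"
    using cd by (intro finite_measure_Diff copula_Times) auto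
  finally show ?thesis by (simp add: strip)
qed

end

text \<open>Lower left quadrants form an intersection-stable generator of the Borel sets. The
  clamping lemma extends agreement from the unit square to all quadrants.\<close>

lemma copula_measure_eqI:
  assumes \<mu>: "copula_measure \<mu>" and \<nu>: "copula_measure \<nu>"
    and eq: "\<And>u v. u \<in> {0..1} \<Longrightarrow> v \<in> {0..1} \<Longrightarrow> cdf2 \<mu> u v = cdf2 \<nu> u v"
  shows "\<mu> = \<nu>"
proof -
  interpret m: prob_space \<mu> using \<mu> by (rule copula_prob_space)
  interpret n: prob_space \<nu> using \<nu> by (rule copula_prob_space)
  have at: "{..p} = {..fst p} \<times> {..snd p}" for p :: "real \<times> real"
    by (auto simp: less_eq_prod_def)
  have gen: "sets borel = sigma_sets UNIV (range (\<lambda>p :: real \<times> real. {..p}))"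
    by (subst borel_eq_atMost) (rule sets_measure_of, simp)
  show ?thesis
  proof (rule measure_eqI_generator_eq[where E = "range (\<lambda>p. {..p})" and \<Omega> = UNIV and A = "\<lambda>i. {..(real i, real i)}"])
    show "Int_stable (range (\<lambda>p :: real \<times> real. {..p}))"
    proof (rule Int_stableI)
      fix A B :: "(real \<times> real) set" assume "A \<in> range (\<lambda>p. {..p})" "B \<in> range (\<lambda>p. {..p})"
      then obtain p q where "A = {..p}" "B = {..q}" by auto
      then have "A \<inter> B = {..inf p q}" by auto
      then show "A \<inter> B \<in> range (\<lambda>p. {..p})" by auto
    qed
    fix A :: "(real \<times> real) set" assume "A \<in> range (\<lambda>p. {..p})"
    then obtain p where p: "A = {..fst p} \<times> {..snd p}" by (auto simp: at)
    have "cdf2 \<mu> u v = cdf2 \<nu> u v" for u v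
      by (subst cdf2_clamp[OF \<mu>], subst cdf2_clamp[OF \<nu>]) (auto intro!: eq)
    then show "emeasure \<mu> A = emeasure \<nu> A"
      by (simp add: p m.emeasure_eq_measure n.emeasure_eq_measure cdf2_def)
  next
    show "(\<Union>i. {..(real i, real i)}) = (UNIV :: (real \<times> real) set)"
    proof (intro set_eqI iffI UNIV_I)
      fix p :: "real \<times> real"
      obtain i where "max (fst p) (snd p) \<le> real i" using real_arch_simple by blast
      then show "p \<in> (\<Union>i. {..(real i, real i)})" by (auto simp: less_eq_prod_def intro!: exI[of _ i])
    qed
    show "sets \<mu> = sigma_sets UNIV (range (\<lambda>p. {..p}))" using copula_sets[OF \<mu>] gen by (rule trans)
    show "sets \<nu> = sigma_sets UNIV (range (\<lambda>p. {..p}))" using copula_sets[OF \<nu>] gen by (rule trans)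
    show "emeasure \<mu> {..(real i, real i)} \<noteq> \<infinity>" for i by simp
  qed auto
qed

text \<open>This resolves the definite description in \<open>copula_meas\<close>: to know the
  measure of the empirical copula it is enough to exhibit one with the right distribution
  function.\<close>

lemma copula_meas_eqI:
  assumes \<mu>: "copula_measure \<mu>"
    and eq: "\<And>u v. u \<in> {0..1} \<Longrightarrow> v \<in> {0..1} \<Longrightarrow> C u v = cdf2 \<mu> u v"
  shows "copula_meas C = \<mu>"
  unfolding copula_meas_def
proof (rule the_equality)
  show "copula_measure \<mu> \<and> (\<forall>x\<in>{0..1}. \<forall>y\<in>{0..1}. C x y = measure \<mu> ({..x} \<times> {..y}))"
    by (simp add: \<mu> eq cdf2_def[symmetric])
  fix \<nu> assume "copula_measure \<nu> \<and> (\<forall>x\<in>{0..1}. \<forall>y\<in>{0..1}. C x y = measure \<nu> ({..x} \<times> {..y}))"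
  then show "\<nu> = \<mu>" using assms by (intro copula_measure_eqI) (auto simp: cdf2_def)
qed

lemma copula_meas_copula:
  assumes "is_copula C"
  shows "copula_measure (copula_meas C)"
proof -
  obtain \<mu> where "copula_measure \<mu>" "\<forall>x\<in>{0..1}. \<forall>y\<in>{0..1}. C x y = measure \<mu> ({..x} \<times> {..y})"
    using assms by (auto simp: is_copula_def)
  moreover from this have "copula_meas C = \<mu>"
    by (intro copula_meas_eqI) (simp_all add: cdf2_def)
  ultimately show ?thesis by simp
qed

section \<open>The measure of the empirical copula\<close>

text \<open>ramp n r x is n times the length of the part of the r-th cell to the left of x.\<close>

definition ramp :: "nat \<Rightarrow> nat \<Rightarrow> real \<Rightarrow> real" where
  "ramp n r x = max 0 (min 1 (real n * x - (real r - 1)))"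

lemma grid_int_atMost:
  assumes "0 < n"
  shows "emeasure lborel (grid_int n r \<inter> {..x}) = ennreal (ramp n r x / real n)"
proof -
  let ?a = "(real r - 1) / real n" and ?b = "real r / real n"
  have "AE t in lborel. t \<noteq> ?b" "AE t in lborel. t \<noteq> x" by (rule AE_lborel_singleton)+
  then have "emeasure lborel (grid_int n r \<inter> {..x}) = emeasure lborel {?a<..min ?b x}"
    by (intro emeasure_eq_AE, eventually_elim) (auto simp: grid_int_def)
  also have "\<dots> = ennreal (ramp n r x / real n)"
  proof (cases "?a \<le> min ?b x")
    case True
    have "min ?b x - ?a = ramp n r x / real n"
      using assms True by (auto simp: ramp_def min_def max_def field_simps)
    with True show ?thesis by simp
  next
    case False
    then have "x < ?a" using assms by (auto simp: min_def field_simps split: if_splits)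
    then have "ramp n r x = 0" using assms by (auto simp: ramp_def field_simps)
    moreover have "{?a<..min ?b x} = {}" using False by auto
    ultimately show ?thesis by (simp only: emeasure_empty) simp
  qed
  finally show ?thesis .
qed

text \<open>The unit cells cut the part of [0,n] to the left of t into the summands. Through
  reindexing along a permutation this gives the uniform margins of the rank measure.\<close>

lemma sum_ramp: "(\<Sum>r\<in>{1..n}. max 0 (min 1 (t - (real r - 1)))) = min (real n) (max 0 t)"
  by (induction n) (auto simp: min_def max_def)

lemma sum_ramp_unit: "x \<in> {0..1} \<Longrightarrow> (\<Sum>r\<in>{1..n}. ramp n r x) = real n * x"
  using mult_left_le[of x "real n"] unfolding ramp_def sum_ramp by simp

text \<open>This is the candidate for the measure of the empirical copula: density n on a cell of
  area 1/n^2 gives every observation mass 1/n, and uniform spreading inside the cell is what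
  bilinear interpolation amounts to.\<close>

definition rank_meas :: "nat \<Rightarrow> (nat \<Rightarrow> nat) \<Rightarrow> (nat \<Rightarrow> nat) \<Rightarrow> (real \<times> real) measure" where
  "rank_meas n R S = density lborel (\<lambda>z. \<Sum>k<n. ennreal (real n) *
      indicator (grid_int n (R k) \<times> grid_int n (S k)) z)"

lemma emeasure_rank_meas:
  assumes [measurable]: "A \<in> sets borel" "B \<in> sets borel"
  shows "emeasure (rank_meas n R S) (A \<times> B) = (\<Sum>k<n. ennreal (real n) *
     (emeasure lborel (grid_int n (R k) \<inter> A) * emeasure lborel (grid_int n (S k) \<inter> B)))"
proof -
  have [measurable]: "grid_int N i \<times> grid_int N j \<in> sets borel" for N i j
    by (intro borel_Times) auto
  have AB[measurable]: "A \<times> B \<in> sets borel" by (intro borel_Times) auto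
  have 1: "emeasure lborel ((E :: real set) \<times> (F :: real set)) = emeasure lborel E * emeasure lborel F"
    if "E \<in> sets borel" "F \<in> sets borel" for E F
    unfolding lborel_prod[symmetric] using that by (subst lborel.emeasure_pair_measure_Times) auto
  have "emeasure (rank_meas n R S) (A \<times> B) = (\<integral>\<^sup>+z. (\<Sum>k<n. ennreal (real n) *
      indicator (grid_int n (R k) \<times> grid_int n (S k)) z) * indicator (A \<times> B) z \<partial>lborel)"
    unfolding rank_meas_def by (subst emeasure_density) auto
  also have "\<dots> = (\<integral>\<^sup>+z. (\<Sum>k<n. ennreal (real n) *
      indicator ((grid_int n (R k) \<inter> A) \<times> (grid_int n (S k) \<inter> B)) z) \<partial>lborel)"
    unfolding sum_distrib_right by (intro nn_integral_cong sum.cong) (auto simp: indicator_def)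
  also have "\<dots> = (\<Sum>k<n. ennreal (real n) *
     emeasure lborel ((grid_int n (R k) \<inter> A) \<times> (grid_int n (S k) \<inter> B)))"
  proof (subst nn_integral_sum)
    have [measurable]: "(grid_int n (R k) \<inter> A) \<times> (grid_int n (S k) \<inter> B) \<in> sets borel" for k
      by (intro borel_Times) auto
    show "(\<lambda>z. ennreal (real n) * indicator ((grid_int n (R k) \<inter> A) \<times> (grid_int n (S k) \<inter> B)) z)
        \<in> borel_measurable lborel" for k
      by measurable
    show "(\<Sum>k<n. \<integral>\<^sup>+z. ennreal (real n) *
        indicator ((grid_int n (R k) \<inter> A) \<times> (grid_int n (S k) \<inter> B)) z \<partial>lborel) =
      (\<Sum>k<n. ennreal (real n) * emeasure lborel ((grid_int n (R k) \<inter> A) \<times> (grid_int n (S k) \<inter> B)))"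
      by (intro sum.cong nn_integral_cmult_indicator) auto
  qed
  finally show ?thesis by (simp add: 1)
qed

context
  fixes n :: nat and R S :: "nat \<Rightarrow> nat"
  assumes n: "0 < n" and R: "bij_betw R {..<n} {1..n}" and S: "bij_betw S {..<n} {1..n}"
begin

text \<open>Describing A and B only through their traces on the cells lets one formula serve
  half-lines, the intervals [0,x], and the whole line with x = 1.\<close>

lemma emeasure_rank_meas_ramp:
  assumes A: "A \<in> sets borel" "\<And>r. r \<in> {1..n} \<Longrightarrow> grid_int n r \<inter> A = grid_int n r \<inter> {..x}"
    and B: "B \<in> sets borel" "\<And>r. r \<in> {1..n} \<Longrightarrow> grid_int n r \<inter> B = grid_int n r \<inter> {..y}"
  shows "emeasure (rank_meas n R S) (A \<times> B) = ennreal ((\<Sum>k<n. ramp n (R k) x * ramp n (S k) y) / real n)"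
proof -
  have rp: "0 \<le> ramp n r x" for r x by (simp add: ramp_def)
  have "R k \<in> {1..n}" "S k \<in> {1..n}" if "k < n" for k
    using bij_betwE[OF R] bij_betwE[OF S] that by auto
  then have "emeasure (rank_meas n R S) (A \<times> B) = (\<Sum>k<n. ennreal (real n) *
     (ennreal (ramp n (R k) x / real n) * ennreal (ramp n (S k) y / real n)))"
    unfolding emeasure_rank_meas[OF A(1) B(1)]
    by (intro sum.cong) (simp_all add: A(2) B(2) grid_int_atMost[OF n])
  also have "\<dots> = (\<Sum>k<n. ennreal (ramp n (R k) x * ramp n (S k) y / real n))"
    using n by (intro sum.cong) (simp_all add: ennreal_mult[symmetric] rp)
  also have "\<dots> = ennreal ((\<Sum>k<n. ramp n (R k) x * ramp n (S k) y) / real n)"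
    by (subst sum_ennreal) (auto simp: rp sum_divide_distrib)
  finally show ?thesis .
qed

lemma ramp_1: "r \<in> {1..n} \<Longrightarrow> ramp n r 1 = 1"
  by (auto simp: ramp_def)

text \<open>Since R and S are bijections onto 1..n, every row and every column of cells is hit once,
  so the ramps of one coordinate sum to n a.\<close>

lemma copula_measure_rank_meas: "copula_measure (rank_meas n R S)"
proof -
  have RS: "R k \<in> {1..n}" "S k \<in> {1..n}" if "k < n" for k
    using bij_betwE[OF R] bij_betwE[OF S] that by auto
  have sub: "grid_int n r \<subseteq> {0..1}" if "r \<in> {1..n}" for r
    using grid_int_subset that by auto
  have g1: "grid_int n r \<inter> UNIV = grid_int n r \<inter> {..1}" if "r \<in> {1..n}" for r
    using sub[OF that] by (auto simp: subset_iff)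
  have g2: "grid_int n r \<inter> {0..x} = grid_int n r \<inter> {..x}" if "r \<in> {1..n}" for r x
    using sub[OF that] by (auto simp: subset_iff)
  have sR: "(\<Sum>k<n. ramp n (R k) a) = real n * a" and sS: "(\<Sum>k<n. ramp n (S k) a) = real n * a"
    if "a \<in> {0..1}" for a
    using sum_ramp_unit[OF that, of n] sum.reindex_bij_betw[OF R, of "\<lambda>r. ramp n r a"]
      sum.reindex_bij_betw[OF S, of "\<lambda>r. ramp n r a"] by simp_all
  have "(\<Sum>k<n. ramp n (R k) 1 * ramp n (S k) 1) = real n" using RS by (simp add: ramp_1)
  then have "emeasure (rank_meas n R S) (UNIV \<times> UNIV) = 1"
    using n by (subst emeasure_rank_meas_ramp[OF _ g1 _ g1]) auto
  then have "prob_space (rank_meas n R S)"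
    by (intro prob_spaceI) (simp add: rank_meas_def)
  moreover have "emeasure (rank_meas n R S) ({0..1} \<times> {0..1}) = 1"
    by (subst emeasure_rank_meas_ramp[where x = 1 and y = 1]) (use n RS in \<open>auto simp: g2 ramp_1\<close>)
  moreover have "measure (rank_meas n R S) ({0..a} \<times> {0..1}) = a" if a: "a \<in> {0..1}" for a
  proof -
    have "(\<Sum>k<n. ramp n (R k) a * ramp n (S k) 1) = real n * a"
      using RS sR[OF a] by (simp add: ramp_1)
    then have "emeasure (rank_meas n R S) ({0..a} \<times> {0..1}) = ennreal a"
      using n by (subst emeasure_rank_meas_ramp[where x = a and y = 1]) (auto simp: g2)
    then show ?thesis using a by (simp add: measure_def)
  qed
  moreover have "measure (rank_meas n R S) ({0..1} \<times> {0..a}) = a" if a: "a \<in> {0..1}" for a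
  proof -
    have "(\<Sum>k<n. ramp n (R k) 1 * ramp n (S k) a) = real n * a"
      using RS sS[OF a] by (simp add: ramp_1)
    then have "emeasure (rank_meas n R S) ({0..1} \<times> {0..a}) = ennreal a"
      using n by (subst emeasure_rank_meas_ramp[where x = 1 and y = a]) (auto simp: g2)
    then show ?thesis using a by (simp add: measure_def)
  qed
  ultimately show ?thesis by (auto simp: copula_measure_def rank_meas_def)
qed

lemma cdf2_rank_meas: "cdf2 (rank_meas n R S) x y = (\<Sum>k<n. ramp n (R k) x * ramp n (S k) y) / real n"
proof -
  have "0 \<le> (\<Sum>k<n. ramp n (R k) x * ramp n (S k) y) / real n"
    by (intro divide_nonneg_nonneg sum_nonneg mult_nonneg_nonneg) (auto simp: ramp_def)
  then show ?thesis
    unfolding cdf2_def measure_def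
    by (subst emeasure_rank_meas_ramp[where x = x and y = y]) auto
qed

end

section \<open>Bilinear interpolation on the grid\<close>

lemma cell_index:
  fixes x :: real
  assumes n: "0 < n" and x: "x \<in> {0..1}" and i: "i = min (nat \<lfloor>real n * x\<rfloor>) (n - 1)"
  shows "i + 1 \<le> n" "real i \<le> real n * x" "real n * x \<le> real i + 1"
proof -
  show "i + 1 \<le> n" using n i by auto
  have nx: "0 \<le> real n * x" "real n * x \<le> real n" using x n by (auto simp: mult_left_le)
  have f: "real (nat \<lfloor>real n * x\<rfloor>) \<le> real n * x" "real n * x < real (nat \<lfloor>real n * x\<rfloor>) + 1"
    using nx by linarith+
  show "real i \<le> real n * x" using f i by linarith
  \<comment> \<open>At x = 1 the floor is n and is capped to n - 1, so this bound is
    attained.\<close>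
  show "real n * x \<le> real i + 1"
  proof (cases "nat \<lfloor>real n * x\<rfloor> \<le> n - 1")
    case True then show ?thesis using f i by auto
  next
    case False then have "i = n - 1" using i by auto
    then show ?thesis using nx n by auto
  qed
qed

text \<open>The two truth values are the ramp at the grid points i/n and (i+1)/n, and the ramp is
  affine in between.\<close>

lemma ramp_interp:
  assumes "real i \<le> real n * x" "real n * x \<le> real i + 1"
  shows "ramp n r x = (1 - (real n * x - real i)) * of_bool (r \<le> i) + (real n * x - real i) * of_bool (r \<le> i + 1)"
proof -
  consider "r \<le> i" | "r = i + 1" | "i + 2 \<le> r" by linarith
  then show ?thesis
  proof cases
    case 1 then show ?thesis using assms by (auto simp: ramp_def)
  next
    case 2 then show ?thesis using assms by (auto simp: ramp_def)
  next
    case 3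
    then have "real i + 2 \<le> real r" by linarith
    then show ?thesis using assms 3 by (auto simp: ramp_def)
  qed
qed

text \<open>Bilinear interpolation is linear in the grid values, which are sums over observations of
  products of a step function in i and one in j; each product interpolates to a product of
  ramps.\<close>

lemma bilin_interp_ranks:
  assumes n: "0 < n" and x: "x \<in> {0..1}" and y: "y \<in> {0..1}"
  shows "bilin_interp n (\<lambda>i j. real (card {k\<in>{..<n}. R k \<le> i \<and> S k \<le> j}) / real n) x y
    = (\<Sum>k<n. ramp n (R k) x * ramp n (S k) y) / real n"
proof -
  define i where "i = min (nat \<lfloor>real n * x\<rfloor>) (n - 1)"
  define j where "j = min (nat \<lfloor>real n * y\<rfloor>) (n - 1)"
  define a where "a = real n * x - real i"
  define b where "b = real n * y - real j"
  have rx: "ramp n r x = (1 - a) * of_bool (r \<le> i) + a * of_bool (r \<le> i + 1)" for r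
    unfolding a_def by (rule ramp_interp) (use cell_index[OF n x i_def] in auto)
  have ry: "ramp n r y = (1 - b) * of_bool (r \<le> j) + b * of_bool (r \<le> j + 1)" for r
    unfolding b_def by (rule ramp_interp) (use cell_index[OF n y j_def] in auto)
  have c: "real (card {k\<in>{..<n}. R k \<le> p \<and> S k \<le> q}) = (\<Sum>k<n. of_bool (R k \<le> p) * of_bool (S k \<le> q))" for p q
    by (simp add: of_bool_conj[symmetric] Int_def)
  have "(\<Sum>k<n. ramp n (R k) x * ramp n (S k) y) =
     (\<Sum>k<n. (1 - a) * (1 - b) * (of_bool (R k \<le> i) * of_bool (S k \<le> j))
       + a * (1 - b) * (of_bool (R k \<le> i + 1) * of_bool (S k \<le> j))
       + (1 - a) * b * (of_bool (R k \<le> i) * of_bool (S k \<le> j + 1))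
       + a * b * (of_bool (R k \<le> i + 1) * of_bool (S k \<le> j + 1)))"
    unfolding rx ry by (intro sum.cong refl) (simp only: algebra_simps)
  then show ?thesis
    unfolding bilin_interp_def Let_def i_def[symmetric] j_def[symmetric] a_def[symmetric] b_def[symmetric] c
    by (simp only: sum.distrib sum_distrib_left[symmetric] add_divide_distrib times_divide_eq_right)
qed

text \<open>The interpolant is a convex combination of four corner values, and each corner is within
  1/n of the point in either coordinate; hence the Lipschitz cost 2/n.\<close>

lemma bilin_interp_close:
  assumes n: "0 < n" and x: "x \<in> {0..1}" and y: "y \<in> {0..1}"
    and lip: "\<And>u v u' v'. \<bar>F u v - F u' v'\<bar> \<le> \<bar>u - u'\<bar> + \<bar>v - v'\<bar>"
    and f: "\<And>i j. i \<le> n \<Longrightarrow> j \<le> n \<Longrightarrow> \<bar>f i j - F (real i / real n) (real j / real n)\<bar> \<le> \<delta>"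
  shows "\<bar>bilin_interp n f x y - F x y\<bar> \<le> \<delta> + 2 / real n"
proof -
  define i where "i = min (nat \<lfloor>real n * x\<rfloor>) (n - 1)"
  define j where "j = min (nat \<lfloor>real n * y\<rfloor>) (n - 1)"
  define a where "a = real n * x - real i"
  define b where "b = real n * y - real j"
  note ci = cell_index[OF n x i_def] and cj = cell_index[OF n y j_def]
  have ab: "0 \<le> a" "a \<le> 1" "0 \<le> b" "b \<le> 1" using ci cj by (auto simp: a_def b_def)
  have near: "\<bar>f p q - F x y\<bar> \<le> \<delta> + 2 / real n" if p: "p \<in> {i, i + 1}" and q: "q \<in> {j, j + 1}" for p q
  proof -
    have "\<bar>real p / real n - x\<bar> \<le> 1 / real n" "\<bar>real q / real n - y\<bar> \<le> 1 / real n"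
      using p q ci cj n by (auto simp: abs_le_iff field_simps)
    moreover have "\<bar>f p q - F (real p / real n) (real q / real n)\<bar> \<le> \<delta>"
      using p q ci cj by (intro f) auto
    ultimately show ?thesis using lip[of "real p / real n" "real q / real n" x y] by simp
  qed
  have "bilin_interp n f x y - F x y = (1 - a) * (1 - b) * (f i j - F x y) + a * (1 - b) * (f (i + 1) j - F x y)
        + (1 - a) * b * (f i (j + 1) - F x y) + a * b * (f (i + 1) (j + 1) - F x y)"
    unfolding bilin_interp_def Let_def i_def[symmetric] j_def[symmetric] a_def[symmetric] b_def[symmetric]
    by (simp add: algebra_simps)
  also have "\<bar>\<dots>\<bar> \<le> (1 - a) * (1 - b) * \<bar>f i j - F x y\<bar> + a * (1 - b) * \<bar>f (i + 1) j - F x y\<bar>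
        + (1 - a) * b * \<bar>f i (j + 1) - F x y\<bar> + a * b * \<bar>f (i + 1) (j + 1) - F x y\<bar>"
    using ab by (intro order_trans[OF abs_triangle_ineq] add_mono) (auto simp: abs_mult)
  also have "\<dots> \<le> (1 - a) * (1 - b) * (\<delta> + 2 / real n) + a * (1 - b) * (\<delta> + 2 / real n)
        + (1 - a) * b * (\<delta> + 2 / real n) + a * b * (\<delta> + 2 / real n)"
    using ab by (intro add_mono mult_left_mono near) auto
  also have "\<dots> = ((1 - a) * (1 - b) + a * (1 - b) + (1 - a) * b + a * b) * (\<delta> + 2 / real n)"
    by (simp only: distrib_right)
  also have "(1 - a) * (1 - b) + a * (1 - b) + (1 - a) * b + a * b = 1" by (simp add: algebra_simps)
  finally have "\<bar>bilin_interp n f x y - F x y\<bar> \<le> 1 * (\<delta> + 2 / real n)" .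
  then show ?thesis by simp
qed

section \<open>Stability under perturbation of the copula\<close>

text \<open>Unlike \<open>emp_subcopula\<close> this counts the observations themselves, so it is a
  mean of independent indicators and Hoeffding's inequality applies.\<close>

definition ecdf :: "(nat \<Rightarrow> real \<times> real) \<Rightarrow> nat \<Rightarrow> real \<Rightarrow> real \<Rightarrow> real" where
  "ecdf p n u v = real (card {k\<in>{..<n}. fst (p k) \<le> u \<and> snd (p k) \<le> v}) / real n"

lemma ecdf_mono: "u \<le> u' \<Longrightarrow> v \<le> v' \<Longrightarrow> ecdf p n u v \<le> ecdf p n u' v'"
  unfolding ecdf_def by (intro divide_right_mono of_nat_mono card_mono) auto

lemma ecdf_clamp:
  assumes "\<And>k. k < n \<Longrightarrow> p k \<in> {0..1} \<times> {0..1}"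
  shows "ecdf p n u v = (if u < 0 \<or> v < 0 then 0 else ecdf p n (min 1 u) (min 1 v))"
proof -
  have "{k\<in>{..<n}. fst (p k) \<le> u \<and> snd (p k) \<le> v} =
    (if u < 0 \<or> v < 0 then {} else {k\<in>{..<n}. fst (p k) \<le> min 1 u \<and> snd (p k) \<le> min 1 v})"
  proof (cases "u < 0 \<or> v < 0")
    case True
    then show ?thesis using assms by (force simp: mem_Times_iff)
  next
    case False
    have "(fst (p k) \<le> u \<and> snd (p k) \<le> v) = (fst (p k) \<le> min 1 u \<and> snd (p k) \<le> min 1 v)" if "k < n" for k
      using assms[OF that] by (auto simp: mem_Times_iff)
    then show ?thesis using False by auto
  qed
  then show ?thesis by (simp add: ecdf_def)
qed

lemma ecdf_close_from_grid:
  assumes cm: "copula_measure \<mu>" and n: "0 < n"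
    and p: "\<And>k. k < n \<Longrightarrow> p k \<in> {0..1} \<times> {0..1}"
    and g: "\<And>i j. i \<le> n \<Longrightarrow> j \<le> n \<Longrightarrow>
      \<bar>ecdf p n (real i / real n) (real j / real n) - cdf2 \<mu> (real i / real n) (real j / real n)\<bar> \<le> e"
  shows "\<bar>ecdf p n u v - cdf2 \<mu> u v\<bar> \<le> e + 2 / real n"
proof -
  have e: "0 \<le> e" using g[of 0 0] by simp
  have unit: "\<bar>ecdf p n x y - cdf2 \<mu> x y\<bar> \<le> e + 2 / real n" if x: "x \<in> {0..1}" and y: "y \<in> {0..1}" for x y
  proof -
    define i where "i = min (nat \<lfloor>real n * x\<rfloor>) (n - 1)"
    define j where "j = min (nat \<lfloor>real n * y\<rfloor>) (n - 1)"
    note ci = cell_index[OF n x i_def] and cj = cell_index[OF n y j_def]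
    have bx: "real i / real n \<le> x" "x \<le> real (i + 1) / real n" 
      and by': "real j / real n \<le> y" "y \<le> real (j + 1) / real n"
      using ci cj n by (auto simp: field_simps)
    have dx: "x - real i / real n \<le> 1 / real n" "real (i + 1) / real n - x \<le> 1 / real n"
       "y - real j / real n \<le> 1 / real n" "real (j + 1) / real n - y \<le> 1 / real n"
      using bx by' by (auto simp: add_divide_distrib)
    have "ecdf p n x y \<le> ecdf p n (real (i + 1) / real n) (real (j + 1) / real n)"
      "ecdf p n (real i / real n) (real j / real n) \<le> ecdf p n x y"
      by (intro ecdf_mono bx by')+
    moreover note g[of "i + 1" "j + 1"] g[of i j] cdf2_increment_le[OF cm bx(1) by'(1)] cdf2_increment_le[OF cm bx(2) by'(2)]
    ultimately show ?thesis using ci(1) cj(1) dx by (simp add: abs_le_iff)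
  qed
  show ?thesis
  proof (cases "u < 0 \<or> v < 0")
    case True
    then show ?thesis using ecdf_clamp[of n p u v, OF p] cdf2_clamp[OF cm, of u v] e by simp
  next
    case False
    then show ?thesis using ecdf_clamp[of n p u v, OF p] cdf2_clamp[OF cm, of u v] unit[of "min 1 u" "min 1 v"] by simp
  qed
qed

text \<open>No order statistics are needed: a rank divided by n is the empirical distribution function at the observation, hence within d of the observation itself, and the event R k <= i is sandwiched between fst (p k) <= i/n - d and fst (p k) <= i/n + d.\<close>

lemma rank_subcopula_close:
  assumes cm: "copula_measure \<mu>" and n: "0 < n"
    and p: "\<And>k. k < n \<Longrightarrow> p k \<in> {0..1} \<times> {0..1}"
    and d: "\<And>u v. \<bar>ecdf p n u v - cdf2 \<mu> u v\<bar> \<le> d"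
    and R: "\<And>k. k < n \<Longrightarrow> R k = card {l\<in>{..<n}. fst (p l) \<le> fst (p k)}"
    and S: "\<And>k. k < n \<Longrightarrow> S k = card {l\<in>{..<n}. snd (p l) \<le> snd (p k)}"
  shows "\<bar>real (card {k\<in>{..<n}. R k \<le> i \<and> S k \<le> j}) / real n - cdf2 \<mu> (real i / real n) (real j / real n)\<bar> \<le> 3 * d"
proof -
  let ?x = "real i / real n" and ?y = "real j / real n"
  have d0: "0 \<le> d" using d[of 0 0] by linarith
  have RU: "\<bar>real (R k) / real n - fst (p k)\<bar> \<le> d" if k: "k < n" for k
  proof -
    have "{l\<in>{..<n}. fst (p l) \<le> fst (p k)} = {l\<in>{..<n}. fst (p l) \<le> fst (p k) \<and> snd (p l) \<le> 1}"
      using p by (auto simp: mem_Times_iff)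
    then have "real (R k) / real n = ecdf p n (fst (p k)) 1" using k by (simp add: ecdf_def R)
    then show ?thesis using d[of "fst (p k)" 1] p[OF k] by (simp add: cdf2_margin1[OF cm] mem_Times_iff)
  qed
  have SV: "\<bar>real (S k) / real n - snd (p k)\<bar> \<le> d" if k: "k < n" for k
  proof -
    have "{l\<in>{..<n}. snd (p l) \<le> snd (p k)} = {l\<in>{..<n}. fst (p l) \<le> 1 \<and> snd (p l) \<le> snd (p k)}"
      using p by (auto simp: mem_Times_iff)
    then have "real (S k) / real n = ecdf p n 1 (snd (p k))" using k by (simp add: ecdf_def S)
    then show ?thesis using d[of 1 "snd (p k)"] p[OF k] by (simp add: cdf2_margin2[OF cm] mem_Times_iff)
  qed
  have iff: "real m / real n \<le> real q / real n \<longleftrightarrow> m \<le> q" for m q using n by (simp add: divide_le_cancel)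
  have "{k\<in>{..<n}. R k \<le> i \<and> S k \<le> j} \<subseteq> {k\<in>{..<n}. fst (p k) \<le> ?x + d \<and> snd (p k) \<le> ?y + d}"
  proof safe
    fix k assume k: "k < n" "R k \<le> i" "S k \<le> j"
    show "fst (p k) \<le> ?x + d" using RU[OF k(1)] k(2) iff[of "R k" i] by linarith
    show "snd (p k) \<le> ?y + d" using SV[OF k(1)] k(3) iff[of "S k" j] by linarith
  qed
  then have "real (card {k\<in>{..<n}. R k \<le> i \<and> S k \<le> j}) / real n \<le> ecdf p n (?x + d) (?y + d)"
    unfolding ecdf_def by (intro divide_right_mono of_nat_mono card_mono) auto
  moreover have "{k\<in>{..<n}. fst (p k) \<le> ?x - d \<and> snd (p k) \<le> ?y - d} \<subseteq> {k\<in>{..<n}. R k \<le> i \<and> S k \<le> j}"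
  proof safe
    fix k assume k: "k < n" "fst (p k) \<le> ?x - d" "snd (p k) \<le> ?y - d"
    show "R k \<le> i" using RU[OF k(1)] k(2) iff[of "R k" i] by linarith
    show "S k \<le> j" using SV[OF k(1)] k(3) iff[of "S k" j] by linarith
  qed
  then have "ecdf p n (?x - d) (?y - d) \<le> real (card {k\<in>{..<n}. R k \<le> i \<and> S k \<le> j}) / real n"
    unfolding ecdf_def by (intro divide_right_mono of_nat_mono card_mono) auto
  \<comment> \<open>One d is the distance of the two distribution functions, and two more are the
    cost of shifting both coordinates by d.\<close>
  ultimately show ?thesis
    using d[of "?x + d" "?y + d"] d[of "?x - d" "?y - d"] d0
      cdf2_increment_le[OF cm, of ?x "?x + d" ?y "?y + d"] cdf2_increment_le[OF cm, of "?x - d" ?x "?y - d" ?y]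
    by linarith
qed

text \<open>Without ties the rank is strictly increasing in the value, hence injective; the number
  of possible ranks then forces surjectivity.\<close>

lemma bij_betw_rank:
  fixes f :: "nat \<Rightarrow> real"
  assumes inj: "inj_on f {..<n}"
  shows "bij_betw (\<lambda>k. card {l\<in>{..<n}. f l \<le> f k}) {..<n} {1..n}"
proof -
  let ?R = "\<lambda>k. card {l\<in>{..<n}. f l \<le> f k}"
  have less: "?R k < ?R l" if "k < n" "l < n" "f k < f l" for k l
  proof (rule psubset_card_mono)
    have "l \<in> {m\<in>{..<n}. f m \<le> f l}" "l \<notin> {m\<in>{..<n}. f m \<le> f k}"
      "{m\<in>{..<n}. f m \<le> f k} \<subseteq> {m\<in>{..<n}. f m \<le> f l}"
      using that by auto
    then show "{m\<in>{..<n}. f m \<le> f k} \<subset> {m\<in>{..<n}. f m \<le> f l}" by blast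
  qed simp
  have "inj_on ?R {..<n}"
  proof (rule inj_onI)
    fix k l assume kl: "k \<in> {..<n}" "l \<in> {..<n}" "?R k = ?R l"
    then have "f k = f l" using less[of k l] less[of l k] by (cases "f k" "f l" rule: linorder_cases) auto
    then show "k = l" using inj kl by (auto dest: inj_onD)
  qed
  moreover have "?R ` {..<n} = {1..n}"
  proof (rule card_subset_eq)
    show "?R ` {..<n} \<subseteq> {1..n}"
    proof safe
      fix k assume k: "k < n"
      have "0 < ?R k" using k by (subst card_gt_0_iff) auto
      moreover have "?R k \<le> card {..<n}" by (intro card_mono) auto
      ultimately show "?R k \<in> {1..n}" by simp
    qed
    show "card (?R ` {..<n}) = card {1..n}" using calculation by (simp add: card_image)
  qed simp
  ultimately show ?thesis by (simp add: bij_betw_def)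
qed

section \<open>Checkerboard regression in terms of the distribution function\<close>

lemma grid_int_unique:
  assumes "0 < N" "x \<in> grid_int N i" "x \<in> grid_int N j"
  shows "i = j"
proof -
  have "real i - 1 < real N * x" "real N * x < real i" "real j - 1 < real N * x" "real N * x < real j"
    using assms by (auto simp: grid_int_def field_simps)
  then have "real i < real (j + 1)" "real j < real (i + 1)" by auto
  then show ?thesis unfolding of_nat_less_iff by simp
qed

lemma cb_regr_on:
  assumes N: "0 < N" and i: "i \<in> {1..N}" and x: "x \<in> grid_int N i"
  shows "cb_regr N \<mu> x = (\<Sum>j\<in>{1..N}. measure \<mu> (grid_int N i \<times> grid_int N j) * (real j - 1 / 2))"
proof -
  have "x \<notin> grid_int N i'" if "i' \<noteq> i" for i' using grid_int_unique[OF N x] that by auto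
  then have "cb_regr N \<mu> x = (\<Sum>i'\<in>{1..N}. if i' = i then \<Sum>j\<in>{1..N}. measure \<mu> (grid_int N i \<times> grid_int N j) * (real j - 1 / 2) else 0)"
    unfolding cb_regr_def
  proof (intro sum.cong refl)
    fix i'
    show "(\<Sum>j\<in>{1..N}. measure \<mu> (grid_int N i' \<times> grid_int N j) * (real j - 1 / 2) * indicator (grid_int N i') x) =
      (if i' = i then \<Sum>j\<in>{1..N}. measure \<mu> (grid_int N i \<times> grid_int N j) * (real j - 1 / 2) else 0)"
      using \<open>i' \<noteq> i \<Longrightarrow> x \<notin> grid_int N i'\<close> x by (cases "i' = i") simp_all
  qed
  then show ?thesis using i by (simp only: sum.delta finite_atLeastAtMost if_True)
qed

text \<open>Consecutive weights differ by 1, so after the rearrangement only the last value of A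
  carries a factor of order N.\<close>

lemma grid_sum_by_parts:
  fixes A :: "nat \<Rightarrow> real"
  shows "(\<Sum>j\<in>{1..N}. (A j - A (j - 1)) * (real j - 1 / 2)) =
    A N * (real N + 1 / 2) - (\<Sum>j\<in>{0..N}. A j) + A 0 / 2"
  by (induction N) (simp_all add: algebra_simps)

text \<open>Bounding the cell masses one by one would cost a factor N^2, which is only enough for s < 1/4; summation by parts brings this down to N.\<close>

lemma cb_regr_diff:
  assumes \<mu>: "copula_measure \<mu>" and \<nu>: "copula_measure \<nu>" and N: "0 < N"
    and e: "\<And>u v. u \<in> {0..1} \<Longrightarrow> v \<in> {0..1} \<Longrightarrow> \<bar>cdf2 \<mu> u v - cdf2 \<nu> u v\<bar> \<le> e"
  shows "\<bar>cb_regr N \<mu> x - cb_regr N \<nu> x\<bar> \<le> 8 * e * real N"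
proof -
  have e0: "0 \<le> e" using e[of 0 0] by simp
  show ?thesis
  proof (cases "\<exists>i\<in>{1..N}. x \<in> grid_int N i")
    case False
    then have "cb_regr N \<mu> x = 0" "cb_regr N \<nu> x = 0"
      unfolding cb_regr_def by (auto intro!: sum.neutral)
    then show ?thesis using e0 by simp
  next
    case True
    then obtain i where i: "i \<in> {1..N}" and x: "x \<in> grid_int N i" by auto
    let ?g = "\<lambda>k. real k / real N"
    \<comment> \<open>The difference of the masses that the two measures give to the column over the
      cell up to height j/N; its increments are the differences of the cell masses.\<close>
    define A where "A j = (cdf2 \<mu> (?g i) (?g j) - cdf2 \<mu> (?g (i - 1)) (?g j))
       - (cdf2 \<nu> (?g i) (?g j) - cdf2 \<nu> (?g (i - 1)) (?g j))" for j
    have rect: "measure m (grid_int N i \<times> grid_int N j) = cdf2 m (?g i) (?g j) - cdf2 m (?g (i - 1)) (?g j)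
       - cdf2 m (?g i) (?g (j - 1)) + cdf2 m (?g (i - 1)) (?g (j - 1))" if m: "copula_measure m" and j: "j \<in> {1..N}" for m j
    proof -
      have g: "grid_int N k = {?g (k - 1) <..< ?g k}" "?g (k - 1) \<le> ?g k" if "k \<in> {1..N}" for k
        using that by (auto simp: grid_int_def of_nat_diff intro!: divide_right_mono)
      show ?thesis unfolding g(1)[OF i] g(1)[OF j] by (rule copula_rectangle[OF m g(2)[OF i] g(2)[OF j]])
    qed
    have "cb_regr N \<mu> x - cb_regr N \<nu> x = (\<Sum>j\<in>{1..N}. (A j - A (j - 1)) * (real j - 1 / 2))"
      unfolding cb_regr_on[OF N i x] sum_subtractf[symmetric]
      by (intro sum.cong refl) (simp add: rect[OF \<mu>] rect[OF \<nu>] A_def left_diff_distrib[symmetric])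
    also have "\<dots> = A N * (real N + 1 / 2) - (\<Sum>j\<in>{0..N}. A j) + A 0 / 2" by (rule grid_sum_by_parts)
    finally have eq: "cb_regr N \<mu> x - cb_regr N \<nu> x = A N * (real N + 1 / 2) - (\<Sum>j\<in>{0..N}. A j) + A 0 / 2" .
    have A: "\<bar>A j\<bar> \<le> 2 * e" if "j \<le> N" for j
    proof -
      have "?g i \<in> {0..1}" "?g (i - 1) \<in> {0..1}" "?g j \<in> {0..1}" using i that N by (auto simp: field_simps)
      then have "\<bar>cdf2 \<mu> (?g i) (?g j) - cdf2 \<nu> (?g i) (?g j)\<bar> \<le> e"
         "\<bar>cdf2 \<mu> (?g (i - 1)) (?g j) - cdf2 \<nu> (?g (i - 1)) (?g j)\<bar> \<le> e" using e by blast+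
      then show ?thesis unfolding A_def by linarith
    qed
    \<comment> \<open>The three terms add up to at most 2 e (N + 1/2) + 2 e (N + 1) + e = 4 e N + 4
      e, and e is at most e N; this is the constant 8.\<close>
    have "\<bar>A N * (real N + 1 / 2)\<bar> \<le> 2 * e * (real N + 1 / 2)"
      using A[of N] by (auto simp: abs_mult intro!: mult_right_mono)
    moreover have "\<bar>\<Sum>j\<in>{0..N}. A j\<bar> \<le> (\<Sum>j\<in>{0..N}. 2 * e)"
      using A by (intro order_trans[OF sum_abs] sum_mono) auto
    moreover have "e \<le> e * real N" using e0 N by (simp add: mult_le_cancel_left1)
    ultimately show ?thesis using A[of 0] unfolding eq by (simp add: algebra_simps)
  qed
qed

section \<open>Discretization error and convergence at Lebesgue points\<close>

lemma grid_int_cover: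
  assumes N: "0 < N" and y: "y \<in> {0..1}" and ny: "\<And>k. k \<le> N \<Longrightarrow> y \<noteq> real k / real N"
  obtains j where "j \<in> {1..N}" "y \<in> grid_int N j"
proof -
  define i where "i = min (nat \<lfloor>real N * y\<rfloor>) (N - 1)"
  note ci = cell_index[OF N y i_def]
  have "real i / real N \<le> y" "y \<le> real (i + 1) / real N" using ci N by (auto simp: field_simps)
  moreover have "y \<noteq> real i / real N" "y \<noteq> real (i + 1) / real N" using ny[of i] ny[of "i + 1"] ci by auto
  ultimately have "y \<in> grid_int N (i + 1)" by (auto simp: grid_int_def)
  with ci show ?thesis by (intro that[of "i + 1"]) auto
qed

text \<open>Replacing the second coordinate by the midpoint of its cell errs by at most 1/(2N) on a
  strip of mass at most 1/N, and the integral is then multiplied by N.\<close>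

lemma cb_regr_discretization:
  assumes cm: "copula_measure \<mu>" and N: "0 < N" and i: "i \<in> {1..N}" and x: "x \<in> grid_int N i"
  shows "\<bar>cb_regr N \<mu> x - real N * (\<integral>z. indicator (grid_int N i) (fst z) * snd z \<partial>\<mu>)\<bar> \<le> 1 / (2 * real N)"
proof -
  interpret prob_space \<mu> using cm by (rule copula_prob_space)
  note [measurable_cong] = copula_sets[OF cm, unfolded borel_prod[symmetric]]
  let ?I = "grid_int N"
  have G[measurable]: "?I i \<times> B \<in> sets \<mu>" if "B \<in> sets borel" for B using that by (intro copula_Times[OF cm]) auto
  define h where "h z = (\<Sum>j\<in>{1..N}. indicator (?I i \<times> ?I j) z * ((real j - 1/2) / real N))" for z :: "real \<times> real"
  define f where "f z = indicator (?I i) (fst z) * snd z" for z :: "real \<times> real"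
  have fm[measurable]: "f \<in> borel_measurable \<mu>" unfolding f_def by measurable
  have fi: "integrable \<mu> f"
    by (rule integrable_const_bound[of _ 1], use copula_AE_square[OF cm] in eventually_elim)
       (auto simp: f_def indicator_def)
  have hi: "integrable \<mu> h" unfolding h_def by (auto intro!: Bochner_Integration.integrable_sum integrable_mult_left integrable_real_indicator simp: emeasure_eq_measure G)
  have "cb_regr N \<mu> x = real N * (\<integral>z. h z \<partial>\<mu>)"
    unfolding cb_regr_on[OF N i x] h_def
    using N by (subst Bochner_Integration.integral_sum)
      (auto simp: sum_distrib_left G emeasure_eq_measure copula_space[OF cm] intro!: integrable_mult_left integrable_real_indicator)
  then have "cb_regr N \<mu> x - real N * (\<integral>z. f z \<partial>\<mu>) = real N * (\<integral>z. h z - f z \<partial>\<mu>)"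
    using hi fi by (simp add: right_diff_distrib)
  moreover have "\<bar>\<integral>z. h z - f z \<partial>\<mu>\<bar> \<le> (\<integral>z. indicator (?I i \<times> UNIV) z * (1 / (2 * real N)) \<partial>\<mu>)"
  proof (rule order_trans[OF integral_abs_bound integral_mono_AE])
    show "integrable \<mu> (\<lambda>z. \<bar>h z - f z\<bar>)" using hi fi by auto
    show "integrable \<mu> (\<lambda>z. indicator (?I i \<times> UNIV) z * (1 / (2 * real N)))"
      by (auto intro!: integrable_mult_left integrable_real_indicator simp: emeasure_eq_measure G)
    \<comment> \<open>Heights k/N belong to no open cell, so h vanishes there; these lines carry no
      mass.\<close>
    have "AE z in \<mu>. \<forall>k. snd z \<noteq> real k / real N" using copula_line2[OF cm] by (subst AE_all_countable) auto
    then show "AE z in \<mu>. \<bar>h z - f z\<bar> \<le> indicator (?I i \<times> UNIV) z * (1 / (2 * real N))"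
      using copula_AE_square[OF cm]
    proof eventually_elim
      case (elim z)
      show ?case
      proof (cases "fst z \<in> ?I i")
        case False
        then show ?thesis by (auto simp: h_def f_def mem_Times_iff indicator_def)
      next
        case True
        obtain j where j: "j \<in> {1..N}" "snd z \<in> ?I j"
          using grid_int_cover[OF N, of "snd z"] elim by (auto simp: mem_Times_iff)
        have "snd z \<notin> ?I j'" if "j' \<noteq> j" for j' using grid_int_unique[OF N j(2)] that by auto
        then have "h z = (\<Sum>j'\<in>{1..N}. if j' = j then (real j - 1/2) / real N else 0)"
          unfolding h_def using True j by (intro sum.cong) (auto simp: indicator_def mem_Times_iff)
        then have "h z = (real j - 1/2) / real N" using j by simp
        moreover have "\<bar>(real j - 1/2) / real N - snd z\<bar> \<le> 1 / (2 * real N)"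
          using j N by (auto simp: grid_int_def abs_le_iff field_simps)
        ultimately show ?thesis using True by (simp add: f_def mem_Times_iff indicator_def)
      qed
    qed
  qed
  moreover have "(\<integral>z. indicator (?I i \<times> UNIV) z * (1 / (2 * real N)) \<partial>\<mu>) \<le> 1 / real N * (1 / (2 * real N))"
  proof -
    have "measure \<mu> (?I i \<times> UNIV) \<le> measure \<mu> ({(real i - 1) / real N<..real i / real N} \<times> UNIV)"
      by (intro finite_measure_mono copula_Times[OF cm]) (auto simp: grid_int_def)
    also have "\<dots> \<le> real i / real N - (real i - 1) / real N"
      by (intro copula_strip1[OF cm] divide_right_mono) auto
    also have "\<dots> = 1 / real N" by (simp add: diff_divide_distrib)
    finally have "measure \<mu> (?I i \<times> UNIV) * (1 / (2 * real N)) \<le> 1 / real N * (1 / (2 * real N))"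
      by (intro mult_right_mono) auto
    then show ?thesis by (simp add: copula_space[OF cm])
  qed
  ultimately have "\<bar>cb_regr N \<mu> x - real N * (\<integral>z. f z \<partial>\<mu>)\<bar> \<le> real N * (1 / real N * (1 / (2 * real N)))"
    by (simp only: abs_mult abs_of_nat) (rule mult_left_mono, auto)
  then show ?thesis using N unfolding f_def by simp
qed

text \<open>The cell containing x is not centred at x, but it lies in the ball of radius 1/N, which
  is just twice as long. Centred Lebesgue points therefore suffice, at the cost of a factor
  2.\<close>

lemma cb_regr_tendsto:
  assumes cm: "copula_measure \<mu>" and K: "markov_kernel_of \<mu> K"
  shows "AE x in lborel. x \<in> {0..1} \<longrightarrow> (\<lambda>N. cb_regr N \<mu> x) \<longlonglongrightarrow> regr K x"
proof -
  interpret prob_space \<mu> using cm by (rule copula_prob_space)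
  note [measurable_cong] = copula_sets[OF cm, unfolded borel_prod[symmetric]]
  define r where "r x = regr K x * indicator {0..1} x" for x
  have r[measurable]: "r \<in> borel_measurable borel" unfolding r_def by (rule regr_measurable[OF K])
  have r01: "0 \<le> r x" "r x \<le> 1" for x
    using regr_nn_integral(2,3)[OF K, of x] by (auto simp: r_def indicator_def)
  then have rb: "\<bar>r x\<bar> \<le> 1" for x by (simp add: abs_le_iff order_trans[of _ 0])
  have bound: "\<bar>cb_regr N \<mu> x - r x\<bar> \<le> 1 / (2 * real N) + 2 * a"
    if N: "0 < N" and i: "i \<in> {1..N}" and x: "x \<in> grid_int N i" and a: "0 < a"
      and B: "(\<integral>\<^sup>+y\<in>ball x (1 / real N). ennreal \<bar>r y - r x\<bar> \<partial>lborel) \<le> ennreal a * emeasure lborel (ball x (1 / real N))"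
    for N i x a
  proof -
    let ?I = "grid_int N i"
    have Isub: "?I \<subseteq> {0..1}" using grid_int_subset i by auto
    have len: "emeasure lborel ?I = ennreal (1 / real N)" "measure lborel ?I = 1 / real N"
      by (simp_all add: grid_int_def diff_divide_distrib divide_right_mono)
    \<comment> \<open>The passage through nonnegative integrals makes the kernel identity available:
      the integral of the second coordinate over the strip is the integral of the regression
      function over the cell.\<close>
    have "ennreal (\<integral>z. indicator ?I (fst z) * snd z \<partial>\<mu>) = (\<integral>\<^sup>+z. ennreal (indicator ?I (fst z) * snd z) \<partial>\<mu>)"
    proof (rule nn_integral_eq_integral[symmetric])
      show "integrable \<mu> (\<lambda>z. indicator ?I (fst z) * snd z)"
        by (rule integrable_const_bound[of _ 1], use copula_AE_square[OF cm] in eventually_elim)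
           (auto simp: indicator_def)
      show "AE z in \<mu>. 0 \<le> indicator ?I (fst z) * snd z"
        using copula_AE_square[OF cm] by eventually_elim (auto simp: indicator_def)
    qed
    also have "\<dots> = (\<integral>\<^sup>+z\<in>?I \<times> {0..1}. ennreal (snd z) \<partial>\<mu>)"
      by (intro nn_integral_cong_AE, use copula_AE_square[OF cm] in eventually_elim)
         (auto simp: indicator_def)
    also have "\<dots> = (\<integral>\<^sup>+y\<in>?I. ennreal (regr K y) \<partial>lborel)"
      by (rule regr_set_nn_integral[OF K copula_sets[OF cm] _ Isub, symmetric]) simp
    also have "\<dots> = (\<integral>\<^sup>+y. ennreal (r y * indicator ?I y) \<partial>lborel)"
      using Isub by (intro nn_integral_cong) (auto simp: r_def indicator_def)
    also have ri: "integrable lborel (\<lambda>y. r y * indicator ?I y)"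
      by (rule Bochner_Integration.integrable_bound[of _ "indicator ?I"])
         (use len rb in \<open>auto simp: indicator_def abs_mult\<close>)
    then have "(\<integral>\<^sup>+y. ennreal (r y * indicator ?I y) \<partial>lborel) = ennreal (\<integral>y. r y * indicator ?I y \<partial>lborel)"
      by (intro nn_integral_eq_integral) (auto simp: r01)
    finally have "ennreal (\<integral>z. indicator ?I (fst z) * snd z \<partial>\<mu>) = ennreal (\<integral>y. r y * indicator ?I y \<partial>lborel)" .
    moreover have "0 \<le> (\<integral>z. indicator ?I (fst z) * snd z \<partial>\<mu>)"
      by (rule integral_nonneg_AE, use copula_AE_square[OF cm] in eventually_elim) (auto simp: indicator_def)
    moreover have "0 \<le> (\<integral>y. r y * indicator ?I y \<partial>lborel)"
      by (rule integral_nonneg_AE) (auto simp: r01)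
    ultimately have eq: "(\<integral>z. indicator ?I (fst z) * snd z \<partial>\<mu>) = (\<integral>y. r y * indicator ?I y \<partial>lborel)"
      by simp
    have ci: "integrable lborel (\<lambda>y. r x * indicator ?I y)"
      using len by (intro integrable_mult_right integrable_real_indicator) auto
    have "(\<integral>y. r x * indicator ?I y \<partial>lborel) = r x / real N" using len by simp
    with ri ci have "(\<integral>y. r y * indicator ?I y \<partial>lborel) - r x / real N = (\<integral>y. r y * indicator ?I y - r x * indicator ?I y \<partial>lborel)"
      by (subst Bochner_Integration.integral_diff) auto
    moreover have "\<bar>\<integral>y. r y * indicator ?I y - r x * indicator ?I y \<partial>lborel\<bar> \<le> a * (2 / real N)"
    proof -
      have "ennreal \<bar>\<integral>y. r y * indicator ?I y - r x * indicator ?I y \<partial>lborel\<bar> \<le>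
          (\<integral>\<^sup>+y. ennreal \<bar>r y * indicator ?I y - r x * indicator ?I y\<bar> \<partial>lborel)"
        using integral_norm_bound_ennreal[OF Bochner_Integration.integrable_diff[OF ri ci]] by simp
      also have "\<dots> \<le> (\<integral>\<^sup>+y\<in>ball x (1 / real N). ennreal \<bar>r y - r x\<bar> \<partial>lborel)"
      proof (intro nn_integral_mono)
        fix y
        have "y \<in> ball x (1 / real N)" if "y \<in> ?I"
          using that x by (auto simp: grid_int_def dist_real_def abs_less_iff diff_divide_distrib)
        then show "ennreal \<bar>r y * indicator ?I y - r x * indicator ?I y\<bar>
          \<le> ennreal \<bar>r y - r x\<bar> * indicator (ball x (1 / real N)) y"
          by (auto simp: indicator_def)
      qed
      also have "\<dots> \<le> ennreal a * emeasure lborel (ball x (1 / real N))" by (rule B)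
      also have "\<dots> = ennreal (a * (2 / real N))"
        using a by (simp add: ball_eq_greaterThanLessThan ennreal_mult[symmetric])
      finally show ?thesis using a by simp
    qed
    ultimately have "\<bar>(\<integral>z. indicator ?I (fst z) * snd z \<partial>\<mu>) - r x / real N\<bar> \<le> a * (2 / real N)"
      unfolding eq by simp
    then have "real N * \<bar>(\<integral>z. indicator ?I (fst z) * snd z \<partial>\<mu>) - r x / real N\<bar> \<le> real N * (a * (2 / real N))"
      by (intro mult_left_mono) auto
    also have "real N * \<bar>(\<integral>z. indicator ?I (fst z) * snd z \<partial>\<mu>) - r x / real N\<bar> =
        \<bar>real N * (\<integral>z. indicator ?I (fst z) * snd z \<partial>\<mu>) - r x\<bar>"
    proof -
      have "real N * t - r x = real N * (t - r x / real N)" for t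
        using N by (simp add: right_diff_distrib)
      then show ?thesis by (simp only: abs_mult abs_of_nat)
    qed
    also have "real N * (a * (2 / real N)) = 2 * a" using N by simp
    finally have "\<bar>real N * (\<integral>z. indicator ?I (fst z) * snd z \<partial>\<mu>) - r x\<bar> \<le> 2 * a" .
    then show ?thesis
      using cb_regr_discretization[OF cm N i x] by linarith
  qed
  \<comment> \<open>The points of all grids together are countable, so every remaining x in [0,1]
    lies in an open cell for each positive N.\<close>
  have "AE x in lborel. \<forall>N k. x \<noteq> real k / real N"
    by (simp add: AE_all_countable AE_lborel_singleton)
  with lebesgue_points[OF r rb] show ?thesis
  proof eventually_elim
    case (elim x)
    show ?case
    proof
      assume x: "x \<in> {0..1}"
      show "(\<lambda>N. cb_regr N \<mu> x) \<longlonglongrightarrow> regr K x"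
      proof (rule tendstoI)
        fix e :: real assume e: "0 < e"
        \<comment> \<open>The two errors are then 2 (e/8) = e/4 and, once 1/N < e, less than
          e/2.\<close>
        then obtain d where d: "d > 0" "\<And>q. 0 < q \<Longrightarrow> q < d \<Longrightarrow>
           (\<integral>\<^sup>+y\<in>ball x q. ennreal \<bar>r y - r x\<bar> \<partial>lborel) \<le> ennreal (e / 8) * emeasure lborel (ball x q)"
          using elim(1)[rule_format, of "e / 8"] by auto
        have "\<forall>\<^sub>F N in sequentially. 1 / real N < min d e"
          using d e by (intro order_tendstoD(2)[OF lim_1_over_n]) auto
        then show "\<forall>\<^sub>F N in sequentially. dist (cb_regr N \<mu> x) (regr K x) < e"
          using eventually_gt_at_top[of 0]
        proof eventually_elim
          case (elim N)
          obtain i where i: "i \<in> {1..N}" "x \<in> grid_int N i"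
            using grid_int_cover[OF elim(2) x] \<open>\<forall>N k. x \<noteq> real k / real N\<close> by blast
          have "\<bar>cb_regr N \<mu> x - r x\<bar> \<le> 1 / (2 * real N) + 2 * (e / 8)"
            using elim e by (intro bound[OF elim(2) i] d) auto
          moreover have "1 / (2 * real N) = (1 / real N) / 2" by simp
          ultimately have "\<bar>cb_regr N \<mu> x - r x\<bar> < e" using elim(1) e by linarith
          then show ?case using x by (simp add: r_def dist_real_def)
        qed
      qed
    qed
  qed
qed

text \<open>The deterministic core: chance enters only through e n. The exceptional x depend on the
  kernels, but there are countably many kernels.\<close>

lemma cb_regr_converges:
  assumes cm: "copula_measure \<mu>" and K: "markov_kernel_of \<mu> K"
    and \<nu>: "\<And>n. copula_measure (\<nu> n)"
    and N: "filterlim N at_top sequentially"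
    and e: "\<And>n u v. u \<in> {0..1} \<Longrightarrow> v \<in> {0..1} \<Longrightarrow> \<bar>cdf2 (\<nu> n) u v - cdf2 \<mu> u v\<bar> \<le> e n"
    and lim: "(\<lambda>n. e n * real (N n)) \<longlonglongrightarrow> 0"
    and Kn: "\<And>n. markov_kernel_of (checkerboard (N n) (\<nu> n)) (Kn n)" and Npos: "\<And>n. 0 < N n"
  shows "AE x in lborel. x \<in> {0..1} \<longrightarrow> (\<lambda>n. regr (Kn n) x) \<longlonglongrightarrow> regr K x"
proof -
  have "AE x in lborel. \<forall>n. x \<in> {0..1} \<longrightarrow> regr (Kn n) x = cb_regr (N n) (\<nu> n) x"
    by (subst AE_all_countable) (blast intro: checkerboard_regr Kn Npos)
  with cb_regr_tendsto[OF cm K] show ?thesis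
  proof eventually_elim
    case (elim x)
    show ?case
    proof
      assume x: "x \<in> {0..1}"
      have "(\<lambda>n. cb_regr (N n) \<mu> x) \<longlonglongrightarrow> regr K x"
        using elim(1) x N by (auto intro: filterlim_compose)
      moreover have "(\<lambda>n. cb_regr (N n) (\<nu> n) x - cb_regr (N n) \<mu> x) \<longlonglongrightarrow> 0"
      proof (rule Lim_null_comparison)
        show "\<forall>\<^sub>F n in sequentially. norm (cb_regr (N n) (\<nu> n) x - cb_regr (N n) \<mu> x) \<le> 8 * (e n * real (N n))"
          using cb_regr_diff[OF \<nu> cm Npos e] by (simp add: mult.assoc)
        show "(\<lambda>n. 8 * (e n * real (N n))) \<longlonglongrightarrow> 0"
          using tendsto_mult[OF tendsto_const[of 8] lim] by simp
      qed
      ultimately have "(\<lambda>n. cb_regr (N n) \<mu> x + (cb_regr (N n) (\<nu> n) x - cb_regr (N n) \<mu> x)) \<longlonglongrightarrow> regr K x + 0"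
        by (rule tendsto_add)
      then show "(\<lambda>n. regr (Kn n) x) \<longlonglongrightarrow> regr K x"
        using elim(2) x by simp
    qed
  qed
qed

text \<open>Regression functions on [0,1] take values in [0,1], so the indicator of the interval
  dominates for every p.\<close>

lemma regr_Lp_converges:
  assumes K: "markov_kernel_of \<mu> K" and Kn: "\<And>n :: nat. markov_kernel_of (\<nu> n) (Kn n)"
    and lim: "AE x in lborel. x \<in> {0..1} \<longrightarrow> (\<lambda>n. regr (Kn n) x) \<longlonglongrightarrow> regr K x"
    and p: "(p::real) \<ge> 1"
  shows "(\<lambda>n. (LINT x:{0..1}|lborel. \<bar>regr (Kn n) x - regr K x\<bar> powr p) powr (1 / p)) \<longlonglongrightarrow> 0"
proof -
  define g where "g n x = \<bar>regr (Kn n) x * indicator {0..1} x - regr K x * indicator {0..1} x\<bar> powr p" for n x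
  have [measurable]: "g n \<in> borel_measurable borel" for n
    using regr_measurable[OF K] regr_measurable[OF Kn[of n]] unfolding g_def by measurable
  have gi: "(LINT x:{0..1}|lborel. \<bar>regr (Kn n) x - regr K x\<bar> powr p) = (\<integral>x. g n x \<partial>lborel)" for n
    unfolding set_lebesgue_integral_def g_def
    by (intro Bochner_Integration.integral_cong) (auto simp: indicator_def)
  have "(\<lambda>n. \<integral>x. g n x \<partial>lborel) \<longlonglongrightarrow> (\<integral>x. 0 \<partial>(lborel :: real measure))"
  proof (rule integral_dominated_convergence[where w = "indicator {0..1}"])
    show "AE x in lborel. norm (g n x) \<le> indicator {0..1} x" for n
    proof (intro AE_I2)
      fix x
      have "\<bar>regr (Kn n) x - regr K x\<bar> powr p \<le> 1 powr p" if "x \<in> {0..1}"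
        using regr_nn_integral(2,3)[OF K that] regr_nn_integral(2,3)[OF Kn[of n] that] p
        by (intro powr_mono2) auto
      then show "norm (g n x) \<le> indicator {0..1} x" by (auto simp: g_def indicator_def)
    qed
    show "AE x in lborel. (\<lambda>n. g n x) \<longlonglongrightarrow> 0"
      using lim
    proof eventually_elim
      case (elim x)
      show ?case
      proof (cases "x \<in> {0..1}")
        case True
        with elim have "(\<lambda>n. \<bar>regr (Kn n) x - regr K x\<bar>) \<longlonglongrightarrow> 0"
          by (simp add: LIM_zero tendsto_rabs_zero)
        then have "(\<lambda>n. \<bar>regr (Kn n) x - regr K x\<bar> powr p) \<longlonglongrightarrow> 0"
          using p by (intro tendsto_zero_powrI[where b = p]) auto
        then show ?thesis using True by (simp add: g_def)
      qed (simp add: g_def)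
    qed
  qed (auto intro!: integrable_real_indicator)
  then have "(\<lambda>n. \<integral>x. g n x \<partial>lborel) \<longlonglongrightarrow> 0" by simp
  moreover have "0 \<le> (\<integral>x. g n x \<partial>lborel)" for n
    by (intro Bochner_Integration.integral_nonneg) (simp add: g_def)
  ultimately show ?thesis
    unfolding gi using p by (intro tendsto_zero_powrI[where b = "1 / p"]) auto
qed

section \<open>Almost sure uniform convergence of the empirical distribution function\<close>

text \<open>The exponent is -2 n^(1-2t); for t < 1/2 it beats the (n+1)^2 grid points, with enough
  to spare for comparison with 1/n^2.\<close>

lemma summable_hoeffding_grid:
  assumes t: "t < 1 / 2"
  shows "summable (\<lambda>n. (real n + 1)\<^sup>2 * (2 * exp (- 2 * real n * (real n powr - t)\<^sup>2)))"
proof (rule summable_comparison_test_ev)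
  define c where "c = 1 - 2 * t"
  have c: "0 < c" using t by (simp add: c_def)
  have "(\<lambda>n. real n ^ 2 * ((real n + 1)\<^sup>2 * (2 * exp (- 2 * real n powr c)))) \<longlonglongrightarrow> 0"
    using c by real_asymp
  then have "\<forall>\<^sub>F n in sequentially. real n ^ 2 * ((real n + 1)\<^sup>2 * (2 * exp (- 2 * real n powr c))) < 1"
    by (rule order_tendstoD) simp
  then show "\<forall>\<^sub>F n in sequentially. norm ((real n + 1)\<^sup>2 * (2 * exp (- 2 * real n * (real n powr - t)\<^sup>2))) \<le> inverse (real n ^ 2)"
    using eventually_gt_at_top[of 0]
  proof eventually_elim
    case (elim n)
    have "real n * (real n powr - t)\<^sup>2 = real n powr 1 * real n powr (- t * 2)"
      using elim by (simp add: powr_power mult.commute)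
    also have "\<dots> = real n powr c" by (simp only: powr_add[symmetric]) (simp add: c_def mult.commute)
    finally have "- 2 * real n * (real n powr - t)\<^sup>2 = - 2 * real n powr c" by (simp only: mult.assoc)
    then show ?case using elim by (simp only:) (simp add: field_simps)
  qed
  show "summable (\<lambda>n. inverse (real n ^ 2))" by (rule inverse_power_summable) simp
qed

text \<open>By independence a pair of observations has the product distribution, and by Fubini the
  diagonal of g is null because its sections are.\<close>

lemma AE_no_ties:
  assumes "prob_space M" and X[measurable]: "\<And>i. X i \<in> borel_measurable M"
    and ind: "prob_space.indep_vars M (\<lambda>_. borel) X UNIV"
    and \<nu>: "\<And>i. distr M borel (X i) = \<nu>" and g[measurable]: "g \<in> borel_measurable borel"
    and null: "\<And>a :: real. AE z in \<nu>. g z \<noteq> a"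
  shows "AE \<omega> in M. \<forall>k l :: nat. k \<noteq> l \<longrightarrow> g (X k \<omega>) \<noteq> g (X l \<omega>)"
proof -
  interpret prob_space M by fact
  have "AE \<omega> in M. g (X k \<omega>) \<noteq> g (X l \<omega>)" if kl: "k \<noteq> l" for k l
  proof -
    \<comment> \<open>Pairwise independence is extracted from the family by restricting to the
      disjoint index sets {k} and {l} and then projecting.\<close>
    have "indep_var (Pi\<^sub>M {k} (\<lambda>_. borel)) (\<lambda>\<omega>. restrict (\<lambda>i. X i \<omega>) {k})
       (Pi\<^sub>M {l} (\<lambda>_. borel)) (\<lambda>\<omega>. restrict (\<lambda>i. X i \<omega>) {l})"
      by (rule indep_var_restrict[OF ind]) (use kl in auto)
    then have "indep_var borel ((\<lambda>f. f k) \<circ> (\<lambda>\<omega>. restrict (\<lambda>i. X i \<omega>) {k}))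
       borel ((\<lambda>f. f l) \<circ> (\<lambda>\<omega>. restrict (\<lambda>i. X i \<omega>) {l}))"
      by (rule indep_var_compose) (auto intro: measurable_component_singleton)
    then have "indep_var borel (X k) borel (X l)" by (simp add: o_def)
    then have eq: "\<nu> \<Otimes>\<^sub>M \<nu> = distr M (borel \<Otimes>\<^sub>M borel) (\<lambda>\<omega>. (X k \<omega>, X l \<omega>))"
      by (simp add: indep_var_distribution_eq \<nu>)
    have ps: "prob_space \<nu>" using prob_space_distr[OF X[of k]] by (simp add: \<nu>)
    interpret \<nu>: prob_space \<nu> by fact
    interpret pair_sigma_finite \<nu> \<nu> ..
    have s[measurable_cong]: "sets \<nu> = sets borel" using \<nu>[of 0, symmetric] by simp
    have "AE p in \<nu> \<Otimes>\<^sub>M \<nu>. g (fst p) \<noteq> g (snd p)"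
    proof (rule AE_pair_measure)
      show "{p \<in> space (\<nu> \<Otimes>\<^sub>M \<nu>). g (fst p) \<noteq> g (snd p)} \<in> sets (\<nu> \<Otimes>\<^sub>M \<nu>)" by measurable
      show "AE x in \<nu>. AE y in \<nu>. g (fst (x, y)) \<noteq> g (snd (x, y))"
        using null by (auto simp: eq_commute)
    qed
    then have "AE p in distr M (borel \<Otimes>\<^sub>M borel) (\<lambda>\<omega>. (X k \<omega>, X l \<omega>)). g (fst p) \<noteq> g (snd p)"
      unfolding eq .
    then show ?thesis by (subst (asm) AE_distr_iff) auto
  qed
  then show ?thesis by (simp add: AE_all_countable)
qed

lemma hoeffding_ecdf:
  assumes "prob_space M" and X[measurable]: "\<And>i. X i \<in> borel_measurable M"
    and ind: "prob_space.indep_vars M (\<lambda>_. borel) X UNIV"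
    and \<nu>: "\<And>i. distr M borel (X i) = \<nu>" and e: "0 \<le> e"
  shows "measure M {\<omega>\<in>space M. e \<le> \<bar>ecdf (\<lambda>k. X k \<omega>) n u v - cdf2 \<nu> u v\<bar>} \<le> 2 * exp (- 2 * real n * e\<^sup>2)"
\<comment> \<open>Without observations the right-hand side is 2; the inequality for means requires a
  nonempty index set.\<close>
proof (cases "n = 0")
  case True
  interpret prob_space M by fact
  show ?thesis using True by (simp add: order_trans[OF prob_le_1])
next
  case False
  interpret prob_space M by fact
  let ?A = "{..u} \<times> {..v}"
  have A[measurable]: "?A \<in> sets borel" by (intro borel_Times) auto
  have im[measurable]: "indicat_real ?A \<in> borel_measurable borel" by measurable
  interpret H: Hoeffding_ineq_iid M "{..<n}" "\<lambda>k \<omega>. indicator ?A (X k \<omega>)" "\<lambda>\<omega>. indicator ?A (X 0 \<omega>)" 0 1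
     "expectation (\<lambda>\<omega>. indicator ?A (X 0 \<omega>))"
  proof unfold_locales
    show "indep_vars (\<lambda>_. borel) (\<lambda>k \<omega>. indicat_real ?A (X k \<omega>)) {..<n}"
      by (rule indep_vars_compose2[OF indep_vars_subset[OF ind subset_UNIV]]) measurable
    fix i
    have d: "distr M borel (\<lambda>\<omega>. indicat_real ?A (X k \<omega>)) = distr \<nu> borel (indicat_real ?A)" for k
      unfolding \<nu>[of k, symmetric] by (subst distr_distr) (auto simp: o_def)
    show "distr M borel (\<lambda>\<omega>. indicat_real ?A (X i \<omega>)) = distr M borel (\<lambda>\<omega>. indicat_real ?A (X 0 \<omega>))"
      unfolding d ..
  qed (auto simp: indicator_def)
  have "expectation (\<lambda>\<omega>. indicat_real ?A (X 0 \<omega>)) = (\<integral>z. indicat_real ?A z \<partial>\<nu>)"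
    unfolding \<nu>[of 0, symmetric] by (subst integral_distr) auto
  also have "\<dots> = cdf2 \<nu> u v"
    unfolding cdf2_def using \<nu>[of 0, symmetric] by simp
  finally have ex: "expectation (\<lambda>\<omega>. indicat_real ?A (X 0 \<omega>)) = cdf2 \<nu> u v" .
  have "ecdf (\<lambda>k. X k \<omega>) n u v = (\<Sum>k\<in>{..<n}. indicator ?A (X k \<omega>)) / real (card {..<n})" for \<omega>
  proof -
    have "(\<Sum>k\<in>{..<n}. indicat_real ?A (X k \<omega>)) = (\<Sum>k\<in>{k\<in>{..<n}. fst (X k \<omega>) \<le> u \<and> snd (X k \<omega>) \<le> v}. 1)"
      by (intro sum.mono_neutral_cong_right) (auto simp: indicator_def mem_Times_iff)
    then show ?thesis by (simp add: ecdf_def)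
  qed
  moreover have "{..<n} \<noteq> {}" using False by auto
  ultimately show ?thesis
    using H.Hoeffding_ineq_abs_ge'[OF e zero_less_one] by (simp add: ex)
qed

lemma AE_eventually_ecdf_grid_close:
  assumes M: "prob_space M" and X[measurable]: "\<And>i. X i \<in> borel_measurable M"
    and ind: "prob_space.indep_vars M (\<lambda>_. borel) X UNIV"
    and \<nu>: "\<And>i. distr M borel (X i) = \<nu>" and t: "t < 1 / 2"
  shows "AE \<omega> in M. \<forall>\<^sub>F n in sequentially. \<forall>i\<le>n. \<forall>j\<le>n.
    \<bar>ecdf (\<lambda>k. X k \<omega>) n (real i / real n) (real j / real n) - cdf2 \<nu> (real i / real n) (real j / real n)\<bar> \<le> real n powr - t"
proof -
  interpret prob_space M by fact
  define B where "B n i j = {\<omega>\<in>space M. real n powr - t \<le>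
    \<bar>ecdf (\<lambda>k. X k \<omega>) n (real i / real n) (real j / real n) - cdf2 \<nu> (real i / real n) (real j / real n)\<bar>}" for n i j
  define A where "A n = (\<Union>p\<in>{..n} \<times> {..n}. B n (fst p) (snd p))" for n
  have fs[measurable]: "(\<lambda>\<omega>. fst (X k \<omega>)) \<in> borel_measurable M" "(\<lambda>\<omega>. snd (X k \<omega>)) \<in> borel_measurable M" for k
    using measurable_compose[OF X borel_measurable_continuous_onI[OF continuous_on_fst[OF continuous_on_id]]]
      measurable_compose[OF X borel_measurable_continuous_onI[OF continuous_on_snd[OF continuous_on_id]]] by simp_all
  \<comment> \<open>As a sum of indicators the count is visibly measurable in omega.\<close>
  have c: "real (card {k\<in>{..<n}. fst (X k \<omega>) \<le> u \<and> snd (X k \<omega>) \<le> v}) = 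
     (\<Sum>k<n. of_bool (fst (X k \<omega>) \<le> u \<and> snd (X k \<omega>) \<le> v))" for n u v \<omega>
    by (simp add: Int_def)
  have [measurable]: "(\<lambda>\<omega>. ecdf (\<lambda>k. X k \<omega>) n u v) \<in> borel_measurable M" for n u v
    unfolding ecdf_def c of_bool_def by measurable
  have Bm[measurable]: "B n i j \<in> sets M" for n i j unfolding B_def by measurable
  have Am: "A n \<in> sets M" for n unfolding A_def by (intro sets.finite_UN) auto
  have "AE \<omega> in M. eventually (\<lambda>n. \<omega> \<in> space M - A n) sequentially"
  proof (rule borel_cantelli_AE1)
    show "summable (\<lambda>n. measure M (A n))"
    proof (rule summable_comparison_test_ev[OF always_eventually summable_hoeffding_grid[OF t]], rule allI)
      fix n
      have "measure M (A n) \<le> (\<Sum>p\<in>{..n} \<times> {..n}. measure M (B n (fst p) (snd p)))"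
        unfolding A_def by (intro finite_measure_subadditive_finite) auto
      also have "\<dots> \<le> (\<Sum>p\<in>{..n} \<times> {..n}. 2 * exp (- 2 * real n * (real n powr - t)\<^sup>2))"
        unfolding B_def by (intro sum_mono hoeffding_ecdf[OF M X ind \<nu>]) auto
      also have "\<dots> = (real n + 1)\<^sup>2 * (2 * exp (- 2 * real n * (real n powr - t)\<^sup>2))"
        by (simp add: power2_eq_square card_cartesian_product algebra_simps)
      finally show "norm (measure M (A n)) \<le> (real n + 1)\<^sup>2 * (2 * exp (- 2 * real n * (real n powr - t)\<^sup>2))" by simp
    qed
  qed (use Am in \<open>auto simp: emeasure_eq_measure\<close>)
  then show ?thesis
  proof eventually_elim
    case (elim \<omega>)
    from elim show ?case
    proof eventually_elim
      case (elim n)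
      then have "\<omega> \<in> space M" "\<And>i j. i \<le> n \<Longrightarrow> j \<le> n \<Longrightarrow> \<omega> \<notin> B n i j" by (auto simp: A_def)
      then show ?case by (auto simp: B_def not_le intro: less_imp_le)
    qed
  qed
qed

section \<open>Strong consistency\<close>

text \<open>Without ties the interpolant is the distribution function of the rank measure. With ties
  its margins can fail to be uniform, and \<open>copula_meas\<close> would then be an unspecified
  value.\<close>

lemma empirical_copula_meas:
  assumes n: "0 < n" and inj: "inj_on (\<lambda>k. fst (X k \<omega>)) {..<n}" "inj_on (\<lambda>k. snd (X k \<omega>)) {..<n}"
  shows "copula_measure (copula_meas (empirical_copula X n \<omega>))"
    and "u \<in> {0..1} \<Longrightarrow> v \<in> {0..1} \<Longrightarrow>
      cdf2 (copula_meas (empirical_copula X n \<omega>)) u v = empirical_copula X n \<omega> u v"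
proof -
  let ?R = "rank1 X n \<omega>" and ?S = "rank2 X n \<omega>"
  have R: "bij_betw ?R {..<n} {1..n}" and S: "bij_betw ?S {..<n} {1..n}"
    using bij_betw_rank[OF inj(1)] bij_betw_rank[OF inj(2)] by (simp_all add: rank1_def[abs_def] rank2_def[abs_def])
  have E: "empirical_copula X n \<omega> u v = cdf2 (rank_meas n ?R ?S) u v" if "u \<in> {0..1}" "v \<in> {0..1}" for u v
    unfolding empirical_copula_def emp_subcopula_def[abs_def]
    by (simp only: bilin_interp_ranks[OF n that] cdf2_rank_meas[OF n R S])
  have eq: "copula_meas (empirical_copula X n \<omega>) = rank_meas n ?R ?S"
    by (rule copula_meas_eqI[OF copula_measure_rank_meas[OF n R S] E])
  show "copula_measure (copula_meas (empirical_copula X n \<omega>))"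
    unfolding eq by (rule copula_measure_rank_meas[OF n R S])
  show "u \<in> {0..1} \<Longrightarrow> v \<in> {0..1} \<Longrightarrow>
      cdf2 (copula_meas (empirical_copula X n \<omega>)) u v = empirical_copula X n \<omega> u v"
    unfolding eq by (rule E[symmetric])
qed

text \<open>Passing from the grid to all points gives e + 2/n, ranks triple this, and interpolation
  adds another 2/n.\<close>

lemma empirical_copula_close:
  assumes cm: "copula_measure \<mu>" and n: "0 < n"
    and p: "\<And>k. X k \<omega> \<in> {0..1} \<times> {0..1}"
    and g: "\<And>i j. i \<le> n \<Longrightarrow> j \<le> n \<Longrightarrow>
      \<bar>ecdf (\<lambda>k. X k \<omega>) n (real i / real n) (real j / real n) - cdf2 \<mu> (real i / real n) (real j / real n)\<bar> \<le> e"
    and u: "u \<in> {0..1}" and v: "v \<in> {0..1}"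
  shows "\<bar>empirical_copula X n \<omega> u v - cdf2 \<mu> u v\<bar> \<le> 3 * e + 8 / real n"
proof -
  have d: "\<bar>ecdf (\<lambda>k. X k \<omega>) n u v - cdf2 \<mu> u v\<bar> \<le> e + 2 / real n" for u v
    by (rule ecdf_close_from_grid[OF cm n p g])
  have "\<bar>emp_subcopula X n \<omega> i j - cdf2 \<mu> (real i / real n) (real j / real n)\<bar> \<le> 3 * (e + 2 / real n)" for i j
    unfolding emp_subcopula_def
    by (rule rank_subcopula_close[OF cm n p d]) (simp_all add: rank1_def rank2_def)
  then have "\<bar>bilin_interp n (emp_subcopula X n \<omega>) u v - cdf2 \<mu> u v\<bar> \<le> 3 * (e + 2 / real n) + 2 / real n"
    by (intro bilin_interp_close[OF n u v cdf2_lipschitz[OF cm]])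
  then show ?thesis by (simp add: empirical_copula_def)
qed

text \<open>The kernels are quantified inside the almost sure statement, so one exceptional set
  serves all versions. They are demanded only eventually: for n = 0 the checkerboard is the zero
  measure and has no kernel.\<close>

theorem theorem23:
  fixes C :: "real \<Rightarrow> real \<Rightarrow> real" and M :: "'a measure"
    and X :: "nat \<Rightarrow> 'a \<Rightarrow> real \<times> real" and s :: real
    and K :: "real \<Rightarrow> real measure"
  assumes "is_copula C"
    and "prob_space M"
    and "\<And>i. X i \<in> borel_measurable M"
    and "prob_space.indep_vars M (\<lambda>_. borel) X UNIV"
    and "\<And>i. distr M borel (X i) = copula_meas C"
    and "0 < s" and "s < 1/2"
    and "markov_kernel_of (copula_meas C) K"
  shows "AE \<omega> in M. \<forall>Kn :: nat \<Rightarrow> real \<Rightarrow> real measure.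
     (\<forall>\<^sub>F n in sequentially. markov_kernel_of
        (checkerboard (nat \<lfloor>real n powr s\<rfloor>) (copula_meas (empirical_copula X n \<omega>))) (Kn n))
     \<longrightarrow> ((AE x in lborel. x \<in> {0..1} \<longrightarrow> (\<lambda>n. regr (Kn n) x) \<longlonglongrightarrow> regr K x) \<and>
          (\<forall>p::real. p \<ge> 1 \<longrightarrow>
             (\<lambda>n. (LINT x:{0..1}|lborel. \<bar>regr (Kn n) x - regr K x\<bar> powr p) powr (1 / p))
               \<longlonglongrightarrow> 0))"
proof -
  define \<mu> where "\<mu> = copula_meas C"
  have cm: "copula_measure \<mu>" unfolding \<mu>_def by (rule copula_meas_copula) fact
  have K: "markov_kernel_of \<mu> K" using assms(8) by (simp add: \<mu>_def)
  note d = assms(5)[folded \<mu>_def]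
  \<comment> \<open>Any exponent strictly between s and 1/2 works; the midpoint is one.\<close>
  define t where "t = (s + 1 / 2) / 2"
  have t: "s < t" "t < 1 / 2" using assms(7) by (simp_all add: t_def)
  define N where "N n = nat \<lfloor>real n powr s\<rfloor>" for n :: nat
  define e where "e n = 3 * real n powr - t + 8 / real n" for n :: nat
  have Nle: "real (N n) \<le> real n powr s" for n by (simp add: N_def)
  have Npos: "0 < N n" if "0 < n" for n
  proof -
    have "1 \<le> real n powr s" using that assms(6) by (intro ge_one_powr_ge_zero) auto
    then show ?thesis by (simp add: N_def)
  qed
  have "filterlim (\<lambda>n. nat \<lfloor>real n powr s\<rfloor>) at_top sequentially"
    using assms(6) by real_asymp
  then have Nlim: "filterlim N at_top sequentially" unfolding N_def[abs_def] .
  have eN: "(\<lambda>n. e n * real (N n)) \<longlonglongrightarrow> 0"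
  proof (rule tendsto_sandwich[of "\<lambda>_. 0"])
    show "\<forall>\<^sub>F n in sequentially. 0 \<le> e n * real (N n)" by (simp add: e_def)
    show "\<forall>\<^sub>F n in sequentially. e n * real (N n) \<le> e n * real n powr s"
      using Nle by (intro always_eventually allI mult_left_mono) (auto simp: e_def)
    have "(\<lambda>n. (3 * real n powr - t + 8 / real n) * real n powr s) \<longlonglongrightarrow> 0"
      using t assms(6) by real_asymp
    then show "(\<lambda>n. e n * real n powr s) \<longlonglongrightarrow> 0" by (simp add: e_def)
  qed simp
  have "AE z in \<mu>. z \<in> {0..1} \<times> {0..1}" by (rule copula_AE_square[OF cm])
  then have "AE \<omega> in M. X k \<omega> \<in> {0..1} \<times> {0..1}" for k
    unfolding d[of k, symmetric] by (rule AE_distrD[OF assms(3)])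
  then have sq: "AE \<omega> in M. \<forall>k. X k \<omega> \<in> {0..1} \<times> {0..1}" by (subst AE_all_countable) blast
  have fst: "AE \<omega> in M. \<forall>k l. k \<noteq> l \<longrightarrow> fst (X k \<omega>) \<noteq> fst (X l \<omega>)"
    by (rule AE_no_ties[OF assms(2-4) d _ copula_line1[OF cm]])
      (intro borel_measurable_continuous_onI continuous_intros)
  have snd: "AE \<omega> in M. \<forall>k l. k \<noteq> l \<longrightarrow> snd (X k \<omega>) \<noteq> snd (X l \<omega>)"
    by (rule AE_no_ties[OF assms(2-4) d _ copula_line2[OF cm]])
      (intro borel_measurable_continuous_onI continuous_intros)
  from sq fst snd AE_eventually_ecdf_grid_close[OF assms(2-4) d t(2)] show ?thesis
  proof eventually_elim
    case (elim \<omega>)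
    show ?case
    proof (intro allI impI)
      fix Kn :: "nat \<Rightarrow> real \<Rightarrow> real measure"
      assume "\<forall>\<^sub>F n in sequentially. markov_kernel_of
        (checkerboard (nat \<lfloor>real n powr s\<rfloor>) (copula_meas (empirical_copula X n \<omega>))) (Kn n)"
      with elim(4) eventually_gt_at_top[of "0::nat"]
      have "\<forall>\<^sub>F n in sequentially. 0 < n \<and>
         markov_kernel_of (checkerboard (N n) (copula_meas (empirical_copula X n \<omega>))) (Kn n) \<and>
         (\<forall>i\<le>n. \<forall>j\<le>n. \<bar>ecdf (\<lambda>k. X k \<omega>) n (real i / real n) (real j / real n)
            - cdf2 \<mu> (real i / real n) (real j / real n)\<bar> \<le> real n powr - t)"
        unfolding N_def by eventually_elim blast
      \<comment> \<open>Kernels and deviation bounds are available only from some index on. Shifting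
        all sequences by m makes the hypotheses hold for every index, and the limits are shifted
        back at the end.\<close>
      then obtain m where m: "\<And>n. m \<le> n \<Longrightarrow> 0 < n"
         "\<And>n. m \<le> n \<Longrightarrow> markov_kernel_of (checkerboard (N n) (copula_meas (empirical_copula X n \<omega>))) (Kn n)"
         "\<And>n i j. m \<le> n \<Longrightarrow> i \<le> n \<Longrightarrow> j \<le> n \<Longrightarrow> \<bar>ecdf (\<lambda>k. X k \<omega>) n (real i / real n) (real j / real n)
            - cdf2 \<mu> (real i / real n) (real j / real n)\<bar> \<le> real n powr - t"
        unfolding eventually_sequentially by blast
      have inj: "inj_on (\<lambda>k. fst (X k \<omega>)) {..<n}" "inj_on (\<lambda>k. snd (X k \<omega>)) {..<n}" for n
        using elim(2,3) unfolding inj_on_def by blast+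
      have Kn: "markov_kernel_of (checkerboard (N (n + m)) (copula_meas (empirical_copula X (n + m) \<omega>))) (Kn (n + m))" for n
        by (rule m(2)) simp
      have lim: "AE x in lborel. x \<in> {0..1} \<longrightarrow> (\<lambda>n. regr (Kn (n + m)) x) \<longlonglongrightarrow> regr K x"
      proof (rule cb_regr_converges[OF cm K _ _ _ _ Kn])
        fix n
        have nm: "0 < n + m" by (rule m(1)) simp
        show "copula_measure (copula_meas (empirical_copula X (n + m) \<omega>))"
          by (rule empirical_copula_meas(1)[where X = X and \<omega> = \<omega>, OF nm inj])
        show "0 < N (n + m)" by (rule Npos[OF nm])
        fix u v :: real assume uv: "u \<in> {0..1}" "v \<in> {0..1}"
        have "\<bar>empirical_copula X (n + m) \<omega> u v - cdf2 \<mu> u v\<bar> \<le> e (n + m)"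
          unfolding e_def
          by (rule empirical_copula_close[where X = X and \<omega> = \<omega>, OF cm nm elim(1)[rule_format] m(3) uv]) auto
        then show "\<bar>cdf2 (copula_meas (empirical_copula X (n + m) \<omega>)) u v - cdf2 \<mu> u v\<bar> \<le> e (n + m)"
          unfolding empirical_copula_meas(2)[where X = X and \<omega> = \<omega>, OF nm inj uv] .
      next
        show "filterlim (\<lambda>n. N (n + m)) at_top sequentially"
          by (rule filterlim_compose[OF Nlim filterlim_add_const_nat_at_top])
        show "(\<lambda>n. e (n + m) * real (N (n + m))) \<longlonglongrightarrow> 0"
          using LIMSEQ_ignore_initial_segment[OF eN, of m] .
      qed
      show "(AE x in lborel. x \<in> {0..1} \<longrightarrow> (\<lambda>n. regr (Kn n) x) \<longlonglongrightarrow> regr K x) \<and>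
          (\<forall>p::real. p \<ge> 1 \<longrightarrow>
             (\<lambda>n. (LINT x:{0..1}|lborel. \<bar>regr (Kn n) x - regr K x\<bar> powr p) powr (1 / p))
               \<longlonglongrightarrow> 0)"
      proof (intro conjI allI impI)
        show "AE x in lborel. x \<in> {0..1} \<longrightarrow> (\<lambda>n. regr (Kn n) x) \<longlonglongrightarrow> regr K x"
          using lim by eventually_elim (auto intro: LIMSEQ_offset[where k = m])
        fix p :: real assume "1 \<le> p"
        then have "(\<lambda>n. (LINT x:{0..1}|lborel. \<bar>regr (Kn (n + m)) x - regr K x\<bar> powr p) powr (1 / p)) \<longlonglongrightarrow> 0"
          by (intro regr_Lp_converges[OF K Kn lim])
        then show "(\<lambda>n. (LINT x:{0..1}|lborel. \<bar>regr (Kn n) x - regr K x\<bar> powr p) powr (1 / p)) \<longlonglongrightarrow> 0"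
          by (rule LIMSEQ_offset[where k = m])
      qed
    qed
  qed
qed

end
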